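(* Let $A$ be a pseudocompact topological $MV$-algebra. Then the Stone-Čech compactification $\beta A$ carries a natural compact topological $MV$-algebra structure such that the canonical embedding $e_A:A\to\beta A$ is a dense topological $MV$-embedding (that is, $e_A$ is a homeomorphism onto a dense subspace of $\beta A$ and is an $MV$-algebra homomorphism).
   Context: An $MV$-algebra is an algebra $(A,\oplus,{}^*,0)$ of type $(2,1,0)$ such that $(A,\oplus,0)$ is a commutative monoid, $x^{**}=x$, $x\oplus 0^*=0^*$ and $(x^*\oplus y)^*\oplus y=(y^*\oplus x)^*\oplus x$ for all $x,y$. A topological $MV$-algebra is an $MV$-algebra $A$ equipped with a topology such that $\oplus:A\times A\to A$ and ${}^*:A\to A$ are continuous. All spaces (in particular underlying spaces of topological $MV$-algebras) are assumed to be Tychonoff. A Tychonoff space is pseudocompact if every continuous real-valued function on it is bounded. "Natural" means that the operations on $\beta A$ are continuous extensions of those of $A$ (along $e_A$). *)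

theory Defs
  imports "HOL-Analysis.Analysis"
begin

section \<open>MV-algebras\<close>

locale MV_algebra =
  fixes C :: "'a set"
    and oplus :: "'a \<Rightarrow> 'a \<Rightarrow> 'a" (infixl "\<oplus>" 65)
    and neg :: "'a \<Rightarrow> 'a"
    and zero :: 'a
  assumes plus_closed: "\<lbrakk>x \<in> C; y \<in> C\<rbrakk> \<Longrightarrow> x \<oplus> y \<in> C"
    and neg_closed: "x \<in> C \<Longrightarrow> neg x \<in> C"
    and zero_closed: "zero \<in> C"
    and plus_assoc: "\<lbrakk>x \<in> C; y \<in> C; z \<in> C\<rbrakk> \<Longrightarrow> (x \<oplus> y) \<oplus> z = x \<oplus> (y \<oplus> z)"
    and plus_commute: "\<lbrakk>x \<in> C; y \<in> C\<rbrakk> \<Longrightarrow> x \<oplus> y = y \<oplus> x"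
    and plus_zero: "x \<in> C \<Longrightarrow> x \<oplus> zero = x"
    and neg_neg: "x \<in> C \<Longrightarrow> neg (neg x) = x"
    and plus_neg_zero: "x \<in> C \<Longrightarrow> x \<oplus> neg zero = neg zero"
    and lukasiewicz: "\<lbrakk>x \<in> C; y \<in> C\<rbrakk> \<Longrightarrow> neg (neg x \<oplus> y) \<oplus> y = neg (neg y \<oplus> x) \<oplus> x"

definition MV_homomorphism ::
  "'a set \<Rightarrow> ('a \<Rightarrow> 'a \<Rightarrow> 'a) \<Rightarrow> ('a \<Rightarrow> 'a) \<Rightarrow> 'a \<Rightarrow>
   'b set \<Rightarrow> ('b \<Rightarrow> 'b \<Rightarrow> 'b) \<Rightarrow> ('b \<Rightarrow> 'b) \<Rightarrow> 'b \<Rightarrow> ('a \<Rightarrow> 'b) \<Rightarrow> bool" where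
  "MV_homomorphism C oplus neg zero D oplus' neg' zero' h \<longleftrightarrow>
     h ` C \<subseteq> D \<and>
     (\<forall>x\<in>C. \<forall>y\<in>C. h (oplus x y) = oplus' (h x) (h y)) \<and>
     (\<forall>x\<in>C. h (neg x) = neg' (h x)) \<and>
     h zero = zero'"


section \<open>Tychonoff and pseudocompact spaces\<close>

text \<open>The library's \<^const>\<open>completely_regular_space\<close> includes no separation axiom.\<close>

definition Tychonoff_space :: "'a topology \<Rightarrow> bool" where
  "Tychonoff_space X \<longleftrightarrow> completely_regular_space X \<and> Hausdorff_space X"

definition pseudocompact_space :: "'a topology \<Rightarrow> bool" where
  "pseudocompact_space X \<longleftrightarrow>
     Tychonoff_space X \<and>
     (\<forall>f. continuous_map X euclideanreal f \<longrightarrow> bounded (f ` topspace X))"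


section \<open>Topological MV-algebras\<close>

text \<open>The underlying set of the algebra is the carrier of the topology, and underlying spaces
  are required to be Tychonoff.\<close>

locale topological_MV_algebra = MV_algebra "topspace X" oplus neg zero
  for X :: "'a topology"
    and oplus :: "'a \<Rightarrow> 'a \<Rightarrow> 'a" (infixl "\<oplus>" 65)
    and neg :: "'a \<Rightarrow> 'a"
    and zero :: 'a +
  assumes Tychonoff: "Tychonoff_space X"
    and continuous_plus: "continuous_map (prod_topology X X) X (\<lambda>(x, y). x \<oplus> y)"
    and continuous_neg: "continuous_map X X neg"


section \<open>The Stone--Cech compactification\<close>

text \<open>Functions between carriers are taken to be extensional, so that the index set of the cube is
  the set of continuous functions from \<open>X\<close> to \<open>[0,1]\<close>, each represented once.\<close>

definition unit_functions :: "'a topology \<Rightarrow> ('a \<Rightarrow> real) set" where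
  "unit_functions X =
     {f \<in> extensional (topspace X). continuous_map X (top_of_set {0..1}) f}"

definition unit_cube :: "'a topology \<Rightarrow> (('a \<Rightarrow> real) \<Rightarrow> real) topology" where
  "unit_cube X = product_topology (\<lambda>f. top_of_set {0..1}) (unit_functions X)"

definition stone_cech_embedding :: "'a topology \<Rightarrow> 'a \<Rightarrow> ('a \<Rightarrow> real) \<Rightarrow> real" where
  "stone_cech_embedding X x = (\<lambda>f\<in>unit_functions X. f x)"

definition stone_cech :: "'a topology \<Rightarrow> (('a \<Rightarrow> real) \<Rightarrow> real) topology" where
  "stone_cech X =
     subtopology (unit_cube X) (unit_cube X closure_of (stone_cech_embedding X ` topspace X))"

definition dense_embedding :: "'a topology \<Rightarrow> 'b topology \<Rightarrow> ('a \<Rightarrow> 'b) \<Rightarrow> bool" where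
  "dense_embedding X Y e \<longleftrightarrow>
     embedding_map X Y e \<and> Y closure_of (e ` topspace X) = topspace Y"

text \<open>The operations on \<open>Y\<close> are continuous and extend those on \<open>X\<close> along \<open>e\<close>; the constant is
  a nullary operation.\<close>

definition continuous_extension_of_operations ::
  "'a topology \<Rightarrow> ('a \<Rightarrow> 'a \<Rightarrow> 'a) \<Rightarrow> ('a \<Rightarrow> 'a) \<Rightarrow> 'a \<Rightarrow>
   'b topology \<Rightarrow> ('b \<Rightarrow> 'b \<Rightarrow> 'b) \<Rightarrow> ('b \<Rightarrow> 'b) \<Rightarrow> 'b \<Rightarrow> ('a \<Rightarrow> 'b) \<Rightarrow> bool" where
  "continuous_extension_of_operations X oplus neg zero Y oplus' neg' zero' e \<longleftrightarrow>
     continuous_map (prod_topology Y Y) Y (\<lambda>(p, q). oplus' p q) \<and>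
     (\<forall>x\<in>topspace X. \<forall>y\<in>topspace X. oplus' (e x) (e y) = e (oplus x y)) \<and>
     continuous_map Y Y neg' \<and>
     (\<forall>x\<in>topspace X. neg' (e x) = e (neg x)) \<and>
     zero' = e zero"


subsection \<open>Characteristic properties of the Stone--Cech compactification\<close>

lemma unit_functions_eq:
  "unit_functions X = mspace (submetric (cfunspace X euclidean_metric)
                        {f. f \<in> topspace X \<rightarrow> {0..1::real}})"
proof -
  have "bounded (f ` topspace X)" if "f \<in> topspace X \<rightarrow> {0..1::real}" for f
    using that by (intro bounded_subset [OF bounded_closed_interval [of 0 1]]) auto
  then show ?thesis
    by (auto simp: unit_functions_def continuous_map_in_subtopology image_subset_iff_funcset)
qed

lemma topspace_unit_cube: "topspace (unit_cube X) = unit_functions X \<rightarrow>\<^sub>E {0..1}"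
  by (simp add: unit_cube_def)

lemma compact_space_unit_cube: "compact_space (unit_cube X)"
  by (simp add: unit_cube_def compact_space_product_topology compact_space_subtopology)

lemma Hausdorff_space_unit_cube: "Hausdorff_space (unit_cube X)"
  by (simp add: unit_cube_def Hausdorff_space_product_topology Hausdorff_space_subtopology)

lemma compact_space_stone_cech: "compact_space (stone_cech X)"
  unfolding stone_cech_def
  by (simp add: closedin_compact_space compact_space_subtopology compact_space_unit_cube)

lemma Hausdorff_space_stone_cech: "Hausdorff_space (stone_cech X)"
  by (simp add: Hausdorff_space_subtopology Hausdorff_space_unit_cube stone_cech_def)

lemma stone_cech_embedding_in_cube:
  "stone_cech_embedding X ` topspace X \<subseteq> topspace (unit_cube X)"
proof -
  have "f x \<in> {0..1}" if "f \<in> unit_functions X" "x \<in> topspace X" for f x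
    using that unfolding unit_functions_def continuous_map_in_subtopology by blast
  then show ?thesis
    by (simp add: image_subset_iff topspace_unit_cube stone_cech_embedding_def
        del: atLeastAtMost_iff)
qed

lemma topspace_stone_cech:
  "topspace (stone_cech X) = unit_cube X closure_of (stone_cech_embedding X ` topspace X)"
  by (simp add: stone_cech_def closure_of_subset_topspace inf.absorb2)

lemma stone_cech_embedding_in:
  "stone_cech_embedding X ` topspace X \<subseteq> topspace (stone_cech X)"
  by (simp add: topspace_stone_cech closure_of_subset stone_cech_embedding_in_cube)

lemma embedding_map_unit_cube:
  assumes "Tychonoff_space X"
  shows "embedding_map X (unit_cube X) (stone_cech_embedding X)"
  using completely_regular_space_cube_embedding_explicit [of X] assms
  unfolding Tychonoff_space_def unit_cube_def stone_cech_embedding_def [abs_def] unit_functions_eq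
  by auto

lemma dense_embedding_stone_cech:
  assumes "Tychonoff_space X"
  shows "dense_embedding X (stone_cech X) (stone_cech_embedding X)"
proof -
  let ?e = "stone_cech_embedding X"
  have "?e ` topspace X \<subseteq> unit_cube X closure_of (?e ` topspace X)"
    using stone_cech_embedding_in [of X] by (simp add: topspace_stone_cech)
  then show ?thesis
    using embedding_map_unit_cube [OF assms]
    using closure_of_subset_topspace [of "unit_cube X" "?e ` topspace X"]
    by (auto simp: dense_embedding_def closure_of_subtopology
        embedding_map_in_subtopology stone_cech_def inf.absorb2)
qed

lemma stone_cech_extension:
  fixes X :: "'a topology" and Y :: "'b topology"
  assumes "compact_space Y" "Hausdorff_space Y" "continuous_map X Y g"
  obtains h where "continuous_map (stone_cech X) Y h"
    "\<And>x. x \<in> topspace X \<Longrightarrow> h (stone_cech_embedding X x) = g x"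
proof -
  let ?eX = "stone_cech_embedding X" and ?eY = "stone_cech_embedding Y"
  define H where "H p = (\<lambda>\<phi>\<in>unit_functions Y. p (restrict (\<phi> \<circ> g) (topspace X)))"
    for p :: "('a \<Rightarrow> real) \<Rightarrow> real"
  have "Tychonoff_space Y"
    unfolding Tychonoff_space_def
    using assms compact_Hausdorff_or_regular_imp_normal_space normal_imp_completely_regular_space
    by blast
  then have embY: "embedding_map Y (unit_cube Y) ?eY"
    by (rule embedding_map_unit_cube)
  then obtain e' where e': "homeomorphic_maps Y (subtopology (unit_cube Y) (?eY ` topspace Y)) ?eY e'"
    by (auto simp: embedding_map_def homeomorphic_map_maps)
  have closed: "closedin (unit_cube Y) (?eY ` topspace Y)"
    using assms(1) embY
    by (meson Hausdorff_space_unit_cube compact_space_def compactin_imp_closedin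
        continuous_map_in_subtopology embedding_map_def homeomorphic_imp_continuous_map
        image_compactin)
  have rK: "restrict (\<phi> \<circ> g) (topspace X) \<in> unit_functions X" if "\<phi> \<in> unit_functions Y" for \<phi>
  proof -
    have "continuous_map X (top_of_set {0..1}) (\<phi> \<circ> g)"
      using that assms(3) continuous_map_compose unfolding unit_functions_def by blast
    then have "continuous_map X (top_of_set {0..1}) (restrict (\<phi> \<circ> g) (topspace X))"
      by (rule continuous_map_eq) auto
    then show ?thesis
      by (simp add: unit_functions_def)
  qed
  have contH: "continuous_map (unit_cube X) (unit_cube Y) H"
    unfolding unit_cube_def continuous_map_componentwise
  proof (intro conjI ballI)
    show "H ` topspace (product_topology (\<lambda>f. top_of_set {0..1}) (unit_functions X))
      \<subseteq> extensional (unit_functions Y)"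
      by (auto simp: H_def)
  next
    fix \<phi> assume "\<phi> \<in> unit_functions Y"
    then show "continuous_map (product_topology (\<lambda>f. top_of_set {0..1}) (unit_functions X))
        (top_of_set {0..1}) (\<lambda>p. H p \<phi>)"
      using continuous_map_product_projection [OF rK] by (simp add: H_def)
  qed
  have HeX: "H (?eX x) = ?eY (g x)" if "x \<in> topspace X" for x
    using that rK by (fastforce simp: H_def stone_cech_embedding_def)
  have gim: "g ` topspace X \<subseteq> topspace Y"
    using assms(3) continuous_map_image_subset_topspace by blast
  have "H ` topspace (stone_cech X) \<subseteq> unit_cube Y closure_of (H ` ?eX ` topspace X)"
    using contH by (simp add: topspace_stone_cech continuous_map_image_closure_subset)
  also have "\<dots> \<subseteq> ?eY ` topspace Y"
    using HeX gim by (intro closure_of_minimal [OF _ closed]) auto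
  finally have "continuous_map (stone_cech X) (subtopology (unit_cube Y) (?eY ` topspace Y)) H"
    using contH
    by (auto simp: continuous_map_in_subtopology stone_cech_def continuous_map_from_subtopology)
  then have "continuous_map (stone_cech X) Y (e' \<circ> H)"
    using e' continuous_map_compose unfolding homeomorphic_maps_def by blast
  moreover have "(e' \<circ> H) (?eX x) = g x" if "x \<in> topspace X" for x
    using that HeX gim e' by (auto simp: homeomorphic_maps_def)
  ultimately show thesis
    using that by blast
qed

end

theory Submission
  imports Defs
begin

text \<open>
  The point is that, for continuous \<open>\<phi>\<close> with values in \<open>[0,1]\<close>, the function \<open>\<phi> (x \<oplus> y)\<close> extends
  continuously to \<open>\<beta>A \<times> \<beta>A\<close>; this follows once its translates in \<open>y\<close> are totally bounded in the
  supremum norm.  Write \<open>x - y\<close> for the truncated difference and \<open>d x y = (x - y) \<oplus> (y - x)\<close>.  A double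
  limit argument shows that zero has a base of neighbourhoods that are down-sets, so \<open>d\<close> induces a
  uniformity.  Pseudocompactness makes it totally bounded, and, since points can be translated by
  differences, it makes every continuous real function uniformly continuous.  As \<open>\<oplus>\<close> is nonexpansive
  for \<open>d\<close>, total boundedness of the translates follows.  The MV identities pass to \<open>\<beta>A\<close> by density.
\<close>

section \<open>MV-algebras\<close>

text \<open>A continuous function on \<open>A\<close> with compact range space extends to the
  compactification by its universal property, but a bounded continuous function on the square of
  \<open>A\<close> need not extend to the product of two compactifications: the square of a
  pseudocompact space can fail to be pseudocompact. This is why joint continuity of the sum does not
  settle the matter and a compactness property of its translates is sought. Two obstacles shape the
  way there. No axiom ties the topology to the order, yet the triangle inequality for
  \<open>d\<close> only bounds a distance from above in the order; without down-sets, small bounds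
  would say nothing about the distance itself. And a recursion along a sequence controls only
  countably many neighbourhoods of zero, whereas continuity at a cluster point asks for an arbitrary
  one; translating by a difference bridges this gap.\<close>

context MV_algebra
begin

section \<open>Natural order, truncated difference and residuation\<close>

lemma plus_left_commute:
  "\<lbrakk>x \<in> C; y \<in> C; z \<in> C\<rbrakk> \<Longrightarrow> x \<oplus> (y \<oplus> z) = y \<oplus> (x \<oplus> z)"
  by (metis plus_assoc plus_commute)

lemmas plus_ac = plus_assoc plus_commute plus_left_commute

lemma zero_plus: "x \<in> C \<Longrightarrow> zero \<oplus> x = x"
  using plus_commute plus_zero zero_closed by metis

lemma one_plus: "x \<in> C \<Longrightarrow> neg zero \<oplus> x = neg zero"
  using plus_commute plus_neg_zero zero_closed neg_closed by metis

lemma neg_plus_self: "x \<in> C \<Longrightarrow> neg x \<oplus> x = neg zero"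
  using lukasiewicz[of "neg zero" x] 
  by (simp add: neg_closed zero_closed neg_neg zero_plus plus_neg_zero)

text \<open>Residual of the sum: the least \<open>z\<close> with
  \<open>x \<sqsubseteq> y \<oplus> z\<close>. On the real unit interval it is
  \<open>max 0 (x - y)\<close>.\<close>

definition minus :: "'a \<Rightarrow> 'a \<Rightarrow> 'a" (infixl "\<ominus>" 65)
  where "x \<ominus> y = neg (neg x \<oplus> y)"

definition le :: "'a \<Rightarrow> 'a \<Rightarrow> bool" (infix "\<sqsubseteq>" 50)
  where "x \<sqsubseteq> y \<longleftrightarrow> neg x \<oplus> y = neg zero"

text \<open>On the real unit interval this is \<open>\<bar>x - y\<bar>\<close>, as one summand is
  zero. In general the distance has values in the algebra, and neighbourhoods of zero serve as
  radii.\<close>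

definition mv_dist :: "'a \<Rightarrow> 'a \<Rightarrow> 'a"
  where "mv_dist x y = (x \<ominus> y) \<oplus> (y \<ominus> x)"

lemma minus_closed: "\<lbrakk>x \<in> C; y \<in> C\<rbrakk> \<Longrightarrow> x \<ominus> y \<in> C"
  by (simp add: minus_def plus_closed neg_closed)

lemma mv_dist_closed: "\<lbrakk>x \<in> C; y \<in> C\<rbrakk> \<Longrightarrow> mv_dist x y \<in> C"
  by (simp add: mv_dist_def minus_closed plus_closed)

lemmas closed = plus_closed neg_closed zero_closed minus_closed mv_dist_closed

lemma neg_minus: "\<lbrakk>x \<in> C; y \<in> C\<rbrakk> \<Longrightarrow> neg (x \<ominus> y) = neg x \<oplus> y"
  by (simp add: minus_def closed neg_neg)

lemma minus_zero: "x \<in> C \<Longrightarrow> x \<ominus> zero = x"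
  by (simp add: minus_def closed neg_neg plus_zero)

lemma minus_self: "x \<in> C \<Longrightarrow> x \<ominus> x = zero"
  by (simp add: minus_def closed neg_neg neg_plus_self)

lemma minus_eq_zero: "\<lbrakk>x \<in> C; y \<in> C\<rbrakk> \<Longrightarrow> x \<sqsubseteq> y \<longleftrightarrow> x \<ominus> y = zero"
  unfolding le_def minus_def using neg_neg closed by metis

text \<open>The Lukasiewicz axiom in disguise: \<open>x \<oplus> (y \<ominus> x)\<close> is the join
  of \<open>x\<close> and \<open>y\<close>.\<close>

lemma join_commute: "\<lbrakk>x \<in> C; y \<in> C\<rbrakk> \<Longrightarrow> x \<oplus> (y \<ominus> x) = y \<oplus> (x \<ominus> y)"
  using lukasiewicz[of x y] by (simp add: minus_def closed plus_commute)

lemma le_iff: "\<lbrakk>x \<in> C; y \<in> C\<rbrakk> \<Longrightarrow> x \<sqsubseteq> y \<longleftrightarrow> x \<oplus> (y \<ominus> x) = y"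
proof
  assume C: "x \<in> C" "y \<in> C"
  show "x \<oplus> (y \<ominus> x) = y" if "x \<sqsubseteq> y"
    using that C join_commute[of x y] by (simp add: minus_eq_zero plus_zero)
  assume "x \<oplus> (y \<ominus> x) = y"
  then have "neg x \<oplus> y = (neg x \<oplus> x) \<oplus> (y \<ominus> x)"
    using C by (simp add: plus_assoc closed)
  then show "x \<sqsubseteq> y"
    using C by (simp add: le_def neg_plus_self one_plus closed)
qed

lemma le_plus: "\<lbrakk>x \<in> C; y \<in> C\<rbrakk> \<Longrightarrow> x \<sqsubseteq> x \<oplus> y"
  by (simp add: le_def plus_assoc[symmetric] neg_plus_self one_plus closed)

lemma le_plus2: "\<lbrakk>x \<in> C; y \<in> C\<rbrakk> \<Longrightarrow> y \<sqsubseteq> x \<oplus> y"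
  using le_plus[of y x] by (simp add: plus_commute)

lemma le_refl: "x \<in> C \<Longrightarrow> x \<sqsubseteq> x"
  by (simp add: le_def neg_plus_self)

lemma zero_le: "x \<in> C \<Longrightarrow> zero \<sqsubseteq> x"
  by (simp add: le_def one_plus)

lemma le_ex: "\<lbrakk>x \<in> C; y \<in> C; x \<sqsubseteq> y\<rbrakk> \<Longrightarrow> \<exists>u\<in>C. y = x \<oplus> u"
  by (metis le_iff minus_closed)

lemma le_trans: "\<lbrakk>x \<sqsubseteq> y; y \<sqsubseteq> z; x \<in> C; y \<in> C; z \<in> C\<rbrakk> \<Longrightarrow> x \<sqsubseteq> z"
  by (metis le_ex le_plus plus_assoc plus_closed)

lemma plus_mono:
  assumes "x \<sqsubseteq> x'" "y \<sqsubseteq> y'" "x \<in> C" "x' \<in> C" "y \<in> C" "y' \<in> C"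
  shows "x \<oplus> y \<sqsubseteq> x' \<oplus> y'"
proof -
  obtain u v where "u \<in> C" "x' = x \<oplus> u" "v \<in> C" "y' = y \<oplus> v"
    using le_ex assms by metis
  moreover have "x \<oplus> u \<oplus> (y \<oplus> v) = (x \<oplus> y) \<oplus> (u \<oplus> v)"
    using calculation assms by (simp add: plus_ac closed)
  ultimately show ?thesis
    using assms by (simp add: le_plus closed)
qed

text \<open>Both sides unfold to \<open>neg x \<oplus> y \<oplus> z = neg zero\<close>. This
  residuation reduces the later inequalities between differences to inequalities between
  sums.\<close>

lemma minus_le_iff:
  "\<lbrakk>x \<in> C; y \<in> C; z \<in> C\<rbrakk> \<Longrightarrow> x \<ominus> y \<sqsubseteq> z \<longleftrightarrow> x \<sqsubseteq> y \<oplus> z"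
  by (simp add: le_def neg_minus plus_assoc closed)

lemma minus_le: "\<lbrakk>x \<in> C; y \<in> C\<rbrakk> \<Longrightarrow> x \<ominus> y \<sqsubseteq> x"
  by (simp add: minus_le_iff le_plus2)

lemma le_plus_minus: "\<lbrakk>x \<in> C; y \<in> C\<rbrakk> \<Longrightarrow> x \<sqsubseteq> y \<oplus> (x \<ominus> y)"
  by (simp add: minus_le_iff[symmetric] closed le_refl)

text \<open>Climb from \<open>z\<close> to \<open>y\<close> and on to \<open>x\<close>. Moving one
  or two summands to the left by residuation yields the triangle inequality and the nonexpansiveness
  of subtraction.\<close>

lemma le_plus_plus_minus:
  assumes "x \<in> C" "y \<in> C" "z \<in> C"
  shows "x \<sqsubseteq> (z \<oplus> (y \<ominus> z)) \<oplus> (x \<ominus> y)"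
proof (rule le_trans)
  show "x \<sqsubseteq> y \<oplus> (x \<ominus> y)"
    using assms by (simp add: le_plus_minus)
  show "y \<oplus> (x \<ominus> y) \<sqsubseteq> (z \<oplus> (y \<ominus> z)) \<oplus> (x \<ominus> y)"
    using assms by (intro plus_mono) (simp_all add: le_plus_minus le_refl closed)
qed (use assms in \<open>simp_all add: closed\<close>)

lemma minus_triangle:
  assumes "x \<in> C" "y \<in> C" "z \<in> C"
  shows "x \<ominus> z \<sqsubseteq> (x \<ominus> y) \<oplus> (y \<ominus> z)"
proof -
  have "x \<sqsubseteq> (z \<oplus> (y \<ominus> z)) \<oplus> (x \<ominus> y)"
    using assms by (rule le_plus_plus_minus)
  then show ?thesis
    using assms by (simp add: minus_le_iff plus_ac closed)
qed

lemma plus_minus_plus_le: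
  assumes "x \<in> C" "y \<in> C" "z \<in> C"
  shows "(x \<oplus> z) \<ominus> (y \<oplus> z) \<sqsubseteq> x \<ominus> y"
proof -
  have "x \<oplus> z \<sqsubseteq> (y \<oplus> (x \<ominus> y)) \<oplus> z"
    using assms by (intro plus_mono) (simp_all add: le_plus_minus le_refl closed)
  then show ?thesis
    using assms by (simp add: minus_le_iff plus_ac closed)
qed

lemma minus_minus_minus_le:
  assumes "x \<in> C" "y \<in> C" "z \<in> C"
  shows "(x \<ominus> z) \<ominus> (y \<ominus> z) \<sqsubseteq> x \<ominus> y"
proof -
  have "x \<sqsubseteq> (z \<oplus> (y \<ominus> z)) \<oplus> (x \<ominus> y)"
    using assms by (rule le_plus_plus_minus)
  then show ?thesis
    using assms by (simp add: minus_le_iff plus_ac closed)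
qed

text \<open>De Morgan dual of \<open>join_commute\<close>: negation turns the meet
  \<open>x \<ominus> (x \<ominus> y)\<close> into the join of \<open>neg x\<close> and
  \<open>neg y\<close>.\<close>

lemma meet_commute:
  assumes "x \<in> C" "y \<in> C"
  shows "x \<ominus> (x \<ominus> y) = y \<ominus> (y \<ominus> x)"
proof -
  have "neg (x \<ominus> (x \<ominus> y)) = neg x \<oplus> (neg y \<ominus> neg x)"
    using assms by (simp add: neg_minus closed) (simp add: minus_def closed neg_neg plus_commute)
  also have "\<dots> = neg y \<oplus> (neg x \<ominus> neg y)"
    using assms by (simp add: join_commute closed)
  also have "\<dots> = neg (y \<ominus> (y \<ominus> x))"
    using assms by (simp add: neg_minus closed) (simp add: minus_def closed neg_neg plus_commute)
  finally show ?thesis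
    using assms neg_neg closed by metis
qed

text \<open>Since \<open>y \<ominus> x\<close> lies below \<open>y\<close>, adding the rest
  \<open>y \<ominus> (y \<ominus> x)\<close> restores \<open>y\<close>, and that rest is the meet.
  So \<open>x\<close> and the two differences determine \<open>y\<close>.\<close>

lemma meet_plus_minus:
  assumes "x \<in> C" "y \<in> C"
  shows "(x \<ominus> (x \<ominus> y)) \<oplus> (y \<ominus> x) = y"
  using assms le_iff[of "y \<ominus> x" y]
  by (simp add: meet_commute minus_le closed plus_commute)

section \<open>The distance with values in the algebra\<close>

lemma mv_dist_self: "x \<in> C \<Longrightarrow> mv_dist x x = zero"
  by (simp add: mv_dist_def minus_self plus_zero closed)

lemma mv_dist_commute: "\<lbrakk>x \<in> C; y \<in> C\<rbrakk> \<Longrightarrow> mv_dist x y = mv_dist y x"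
  by (simp add: mv_dist_def plus_commute closed)

lemma mv_dist_triangle:
  assumes "x \<in> C" "y \<in> C" "z \<in> C"
  shows "mv_dist x z \<sqsubseteq> mv_dist x y \<oplus> mv_dist y z"
proof -
  have "mv_dist x z \<sqsubseteq> ((x \<ominus> y) \<oplus> (y \<ominus> z)) \<oplus> ((z \<ominus> y) \<oplus> (y \<ominus> x))"
    unfolding mv_dist_def using assms
    by (intro plus_mono) (simp_all add: minus_triangle closed)
  then show ?thesis
    using assms by (simp add: mv_dist_def plus_ac closed)
qed

lemma mv_dist_plus_le:
  assumes "x \<in> C" "y \<in> C" "z \<in> C"
  shows "mv_dist (x \<oplus> z) (y \<oplus> z) \<sqsubseteq> mv_dist x y"
  unfolding mv_dist_def using assms
  by (intro plus_mono) (simp_all add: plus_minus_plus_le closed)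

lemma mv_dist_minus_le:
  assumes "x \<in> C" "y \<in> C" "z \<in> C"
  shows "mv_dist (x \<ominus> z) (y \<ominus> z) \<sqsubseteq> mv_dist x y"
  unfolding mv_dist_def using assms
  by (intro plus_mono) (simp_all add: minus_minus_minus_le closed)

text \<open>The witness is \<open>z - w + x\<close>, computed in two truncated steps.\<close>

lemma mv_dist_translate:
  assumes "x \<in> C" "w \<in> C" "z \<in> C"
  obtains v where "v \<in> C" "mv_dist v z \<sqsubseteq> mv_dist w x" "mv_dist v x \<sqsubseteq> mv_dist z w"
proof
  let ?u = "z \<ominus> (w \<ominus> x)"
  let ?v = "?u \<oplus> (x \<ominus> w)"
  show vC: "?v \<in> C"
    using assms by (simp add: closed)
  \<comment> \<open>By \<open>meet_plus_minus\<close> the second argument is \<open>x\<close>: the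
    two steps that lead from \<open>z\<close> to \<open>?v\<close> lead from \<open>w\<close> to
    \<open>x\<close>, and both are nonexpansive.\<close>
  have "mv_dist ?v ((w \<ominus> (w \<ominus> x)) \<oplus> (x \<ominus> w)) \<sqsubseteq> mv_dist ?u (w \<ominus> (w \<ominus> x))"
    using assms by (intro mv_dist_plus_le) (simp_all add: closed)
  then have "mv_dist ?v x \<sqsubseteq> mv_dist ?u (w \<ominus> (w \<ominus> x))"
    using assms by (simp only: meet_plus_minus)
  moreover have "mv_dist ?u (w \<ominus> (w \<ominus> x)) \<sqsubseteq> mv_dist z w"
    using assms by (intro mv_dist_minus_le) (simp_all add: closed)
  ultimately show "mv_dist ?v x \<sqsubseteq> mv_dist z w"
    by (rule le_trans) (use assms in \<open>simp_all add: closed\<close>)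
  \<comment> \<open>Truncation is harmless: \<open>?v\<close> differs from \<open>z\<close> at most
    by what was subtracted and what was added.\<close>
  have "z \<oplus> zero \<sqsubseteq> ((w \<ominus> x) \<oplus> ?u) \<oplus> (x \<ominus> w)"
    using assms by (intro plus_mono) (simp_all add: le_plus_minus zero_le closed)
  then have "z \<sqsubseteq> ?v \<oplus> (w \<ominus> x)"
    using assms by (simp add: plus_zero plus_ac closed)
  then have 1: "z \<ominus> ?v \<sqsubseteq> w \<ominus> x"
    using assms by (simp add: minus_le_iff closed)
  have "?v \<sqsubseteq> z \<oplus> (x \<ominus> w)"
    using assms by (intro plus_mono) (simp_all add: closed minus_le le_refl)
  then have 2: "?v \<ominus> z \<sqsubseteq> x \<ominus> w"
    using assms by (simp add: minus_le_iff closed)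
  have "(z \<ominus> ?v) \<oplus> (?v \<ominus> z) \<sqsubseteq> mv_dist w x"
    unfolding mv_dist_def using 1 2 assms vC by (intro plus_mono) (simp_all add: closed)
  then show "mv_dist ?v z \<sqsubseteq> mv_dist w x"
    using assms vC by (simp add: mv_dist_def plus_commute closed)
qed

end

section \<open>Pseudocompact spaces\<close>

text \<open>If the sets were locally finite, bump functions with growing peaks, the
  \<open>n\<close>-th vanishing outside \<open>U n\<close>, would add up to an unbounded continuous
  function.\<close>

lemma pseudocompact_cluster_point:
  fixes U :: "nat \<Rightarrow> 'a set"
  assumes X: "pseudocompact_space X"
    and U: "\<And>n. openin X (U n)" "\<And>n. U n \<noteq> {}"
  shows "\<exists>x\<in>topspace X. \<forall>G N. openin X G \<and> x \<in> G \<longrightarrow> (\<exists>n\<ge>N. G \<inter> U n \<noteq> {})"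
proof (rule ccontr)
  assume "\<not> ?thesis"
  then have "\<forall>x\<in>topspace X. \<exists>G N. openin X G \<and> x \<in> G \<and> (\<forall>n\<ge>N. G \<inter> U n = {})"
    by (simp add: not_ex) 
  then obtain G N where G: "\<And>x. x \<in> topspace X \<Longrightarrow> openin X (G x)"
    "\<And>x. x \<in> topspace X \<Longrightarrow> x \<in> G x"
    and N: "\<And>x n. \<lbrakk>x \<in> topspace X; N x \<le> n\<rbrakk> \<Longrightarrow> G x \<inter> U n = {}"
    by metis
  have "\<forall>n. \<exists>x. x \<in> U n"
    using U(2) by blast
  then obtain p where p: "\<And>n. p n \<in> U n"
    by metis
  \<comment> \<open>The \<open>+ 1\<close> keeps the peak apart from the value 0 outside
    \<open>U n\<close>, also for \<open>n = 0\<close>.\<close>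
  have "\<exists>f. continuous_map X euclideanreal f \<and> f (p n) = real n + 1 \<and> (\<forall>x\<in>topspace X - U n. f x = 0)" for n
    using X U(1)[of n] p[of n] completely_regular_space_gen_alt'[of "real n + 1" 0 X]
    unfolding pseudocompact_space_def Tychonoff_space_def by (auto simp: image_subset_iff)
  then have "\<exists>g. \<forall>n. continuous_map X euclideanreal (g n) \<and> g n (p n) = real n + 1 \<and>
      (\<forall>x\<in>topspace X - U n. g n x = 0)"
    by (intro choice) blast
  then obtain g where g: "\<And>n. continuous_map X euclideanreal (g n)" "\<And>n. g n (p n) = real n + 1"
    and g0: "\<And>n x. \<lbrakk>x \<in> topspace X; x \<notin> U n\<rbrakk> \<Longrightarrow> g n x = 0"
    by blast
  \<comment> \<open>Absolute values, because the \<open>U n\<close> may overlap and no other term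
    may cancel the peak at \<open>p n\<close>.\<close>
  define f where "f x = (\<Sum>n | x \<in> U n. \<bar>g n x\<bar>)" for x
  have sub: "{n. y \<in> U n} \<subseteq> {..<N x}" if "x \<in> topspace X" "y \<in> G x" for x y
  proof
    fix n assume "n \<in> {n. y \<in> U n}"
    then show "n \<in> {..<N x}"
      using N[OF that(1), of n] that(2) by (cases "N x \<le> n") auto
  qed
  have eq: "f y = (\<Sum>n<N x. \<bar>g n y\<bar>)" if "x \<in> topspace X" "y \<in> G x" for x y
    unfolding f_def
  proof (rule sum.mono_neutral_left)
    show "\<forall>i\<in>{..<N x} - {n. y \<in> U n}. \<bar>g i y\<bar> = 0"
      using g0 that(2) openin_subset[OF G(1)[OF that(1)]] by auto
  qed (use sub[OF that] in auto)
  have cont: "continuous_map X euclideanreal (\<lambda>y. \<Sum>n<N x. \<bar>g n y\<bar>)" for x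
    by (intro continuous_map_sum continuous_map_real_abs g) auto
  have "continuous_map X euclideanreal f"
    unfolding continuous_map_eq_topcontinuous_at topcontinuous_at_def
  proof (intro ballI conjI allI impI)
    fix x V assume x: "x \<in> topspace X" and V: "openin euclideanreal V \<and> f x \<in> V"
    let ?W = "{y \<in> topspace X. (\<Sum>n<N x. \<bar>g n y\<bar>) \<in> V}"
    have "openin X (?W \<inter> G x)"
      using openin_continuous_map_preimage[OF cont] V G x by blast
    then show "\<exists>U. openin X U \<and> x \<in> U \<and> (\<forall>y\<in>U. f y \<in> V)"
      using eq[OF x] G[OF x] V x by (intro exI[of _ "?W \<inter> G x"]) auto
  qed auto
  then have "bounded (f ` topspace X)"
    using X by (simp add: pseudocompact_space_def)
  then obtain b where b: "\<And>x. x \<in> topspace X \<Longrightarrow> \<bar>f x\<bar> \<le> b"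
    by (auto simp: bounded_iff)
  obtain n where n: "b < real n"
    using reals_Archimedean2 by blast
  have pX: "p n \<in> topspace X"
    using p U(1) openin_subset by blast
  have "finite {m. p n \<in> U m}"
    using sub[OF pX G(2)[OF pX]] finite_subset by blast
  then have "\<bar>g n (p n)\<bar> \<le> f (p n)"
    unfolding f_def using p by (intro member_le_sum) auto
  then show False
    using g(2)[of n] b[OF pX] n by auto
qed
text \<open>An open form of Grothendieck's double limit criterion; \<open>f\<close> is only separately
  continuous.\<close>

lemma pseudocompact_double_limit:
  fixes f :: "'a \<Rightarrow> 'b \<Rightarrow> real" and U :: "nat \<Rightarrow> 'a set" and W :: "nat \<Rightarrow> 'b set"
  assumes X: "pseudocompact_space X" and Y: "pseudocompact_space Y"
    and fX: "\<And>y. y \<in> topspace Y \<Longrightarrow> continuous_map X euclideanreal (\<lambda>x. f x y)"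
    and fY: "\<And>x. x \<in> topspace X \<Longrightarrow> continuous_map Y euclideanreal (f x)"
    and U: "\<And>n. openin X (U n)" and W: "\<And>n. openin Y (W n)" "\<And>n. W (Suc n) \<subseteq> W n"
    and x: "\<And>n. x n \<in> U n" and F: "\<And>n. finite (F n)" "\<And>n. F n \<subseteq> W n"
    and c: "\<And>n x y. \<lbrakk>x \<in> U n; y \<in> W (Suc n)\<rbrakk> \<Longrightarrow> f x y \<le> c"
    and d: "\<And>m n. m \<le> n \<Longrightarrow> \<exists>y\<in>F m. d \<le> f (x n) y"
  shows "d \<le> c"
proof (rule ccontr)
  assume "\<not> d \<le> c"
  \<comment> \<open>Each passage to a cluster point weakens a strict bound to a weak one; the two
    levels leave room for passing first to \<open>p\<close> and then to \<open>q\<close>.\<close>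
  then obtain e e' where e: "c < e'" "e' < e" "e < d"
    using dense not_le by metis
  have UX: "U n \<subseteq> topspace X" for n
    using U openin_subset by blast
  have FY: "F n \<subseteq> topspace Y" for n
    using W(1)[of n] F(2)[of n] openin_subset by blast
  obtain h where h: "\<And>m n. m \<le> n \<Longrightarrow> h m n \<in> F m" "\<And>m n. m \<le> n \<Longrightarrow> d \<le> f (x n) (h m n)"
    using d by metis
  have hY: "h m n \<in> topspace Y" if "m \<le> n" for m n
    using h(1)[OF that] FY by blast
  have gtX: "openin X {x \<in> topspace X. f x y \<in> T}" if "y \<in> topspace Y" "open T" for y T
    using openin_continuous_map_preimage[OF fX] that by auto
  have gtY: "openin Y {y \<in> topspace Y. f x y \<in> T}" if "x \<in> topspace X" "open T" for x T
    using openin_continuous_map_preimage[OF fY] that by auto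
  define U' where "U' n = U n \<inter> (\<Inter>m\<in>{..n}. {x \<in> topspace X. f x (h m n) \<in> {e<..}})" for n
  have opU: "openin X (U' n)" for n
    unfolding U'_def using hY
    by (intro openin_Int U openin_INT2 gtX) auto
  have neU: "U' n \<noteq> {}" for n
  proof -
    have "x n \<in> U' n"
      unfolding U'_def using x[of n] UX[of n] h(2)[of _ n] e(3) by (auto intro: less_le_trans)
    then show ?thesis by blast
  qed
  obtain p where p: "p \<in> topspace X"
    and "\<forall>G N. openin X G \<and> p \<in> G \<longrightarrow> (\<exists>n\<ge>N. G \<inter> U' n \<noteq> {})"
    using pseudocompact_cluster_point[of X U', OF X opU neU] by blast
  then have pU: "\<And>G N. \<lbrakk>openin X G; p \<in> G\<rbrakk> \<Longrightarrow> \<exists>n\<ge>N. G \<inter> U' n \<noteq> {}"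
    by simp
  \<comment> \<open>The point \<open>h m n\<close> changes with \<open>n\<close> but stays in the
    finite set \<open>F m\<close>. If \<open>f p\<close> were below \<open>e\<close> on all of
    \<open>F m\<close>, the same would hold near \<open>p\<close>, against the sets
    \<open>U' n\<close> clustering there.\<close>
  have "\<exists>y\<in>F m. e \<le> f p y" for m
  proof (rule ccontr)
    assume neg: "\<not> (\<exists>y\<in>F m. e \<le> f p y)"
    let ?G = "topspace X \<inter> (\<Inter>y\<in>F m. {x \<in> topspace X. f x y \<in> {..<e}})"
    have "openin X {x \<in> topspace X. f x y \<in> {..<e}}" if "y \<in> F m" for y
      using that FY by (intro gtX) auto
    then have "openin X ?G"
      using F(1) by (cases "F m = {}") (simp, intro openin_Int openin_INT2 openin_topspace)
    moreover have "p \<in> ?G"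
      using p neg by auto
    ultimately have "\<exists>n\<ge>m. ?G \<inter> U' n \<noteq> {}"
      by (rule pU)
    then obtain n q where n: "m \<le> n" and q: "q \<in> ?G" "q \<in> U' n"
      by blast
    have "f q (h m n) < e"
      using q(1) h(1)[OF n] by auto
    moreover have "e < f q (h m n)"
      using q(2) n by (auto simp: U'_def)
    ultimately show False
      by simp
  qed
  then obtain y where y: "\<And>m. y m \<in> F m" "\<And>m. e \<le> f p (y m)"
    by metis
  define W' where "W' m = W m \<inter> {y \<in> topspace Y. f p y \<in> {e'<..}}" for m
  have opW: "openin Y (W' m)" for m
    unfolding W'_def using p by (intro openin_Int W gtY) auto
  have neW: "W' m \<noteq> {}" for m
  proof -
    have "y m \<in> W' m"
      unfolding W'_def using y[of m] F(2)[of m] FY[of m] e by auto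
    then show ?thesis by blast
  qed
  obtain q where q: "q \<in> topspace Y"
    and "\<forall>G N. openin Y G \<and> q \<in> G \<longrightarrow> (\<exists>n\<ge>N. G \<inter> W' n \<noteq> {})"
    using pseudocompact_cluster_point[of Y W', OF Y opW neW] by blast
  then have qW: "\<And>G N. \<lbrakk>openin Y G; q \<in> G\<rbrakk> \<Longrightarrow> \<exists>n\<ge>N. G \<inter> W' n \<noteq> {}"
    by simp
  have "e' \<le> f p q"
  proof (rule ccontr)
    assume "\<not> e' \<le> f p q"
    then have "\<exists>n\<ge>0. {y \<in> topspace Y. f p y \<in> {..<e'}} \<inter> W' n \<noteq> {}"
      using q p by (intro qW gtY) auto
    then show False
      by (auto simp: W'_def)
  qed
  have dec: "W n \<subseteq> W m" if "m \<le> n" for m n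
    using W(2) lift_Suc_antimono_le that by metis
  \<comment> \<open>For fixed \<open>x\<close>, the sets \<open>W' m\<close> lie in
    \<open>W (Suc n)\<close> from \<open>m = Suc n\<close> on, where \<open>f x\<close> is at most
    \<open>c\<close>; the bound passes to their cluster point \<open>q\<close>.\<close>
  have fq: "f x q \<le> c" if xU: "x \<in> U n" for x n
  proof (rule ccontr)
    assume "\<not> f x q \<le> c"
    then have "\<exists>m\<ge>Suc n. {y \<in> topspace Y. f x y \<in> {c<..}} \<inter> W' m \<noteq> {}"
      using q UX xU by (intro qW gtY) auto
    then obtain m y where "Suc n \<le> m" "c < f x y" "y \<in> W m"
      by (auto simp: W'_def)
    then show False
      using c[OF xU, of y] dec[of "Suc n" m] by auto
  qed
  have "f p q \<le> c"
  proof (rule ccontr)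
    assume "\<not> f p q \<le> c"
    then have "\<exists>n\<ge>0. {x \<in> topspace X. f x q \<in> {c<..}} \<inter> U' n \<noteq> {}"
      using q p by (intro pU gtX) auto
    then show False
      using fq by (force simp: U'_def)
  qed
  then show False
    using \<open>e' \<le> f p q\<close> e by linarith
qed

section \<open>Solid neighbourhoods of zero\<close>

lemma continuous_map_prod_nbhd:
  assumes "continuous_map (prod_topology Y Z) T (\<lambda>(x, y). f x y)" "openin T G"
    "x \<in> topspace Y" "y \<in> topspace Z" "f x y \<in> G"
  obtains U V where "openin Y U" "openin Z V" "x \<in> U" "y \<in> V"
    "\<And>x y. \<lbrakk>x \<in> U; y \<in> V\<rbrakk> \<Longrightarrow> f x y \<in> G"
proof -
  let ?P = "{z \<in> topspace (prod_topology Y Z). (\<lambda>(x, y). f x y) z \<in> G}"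
  have "openin (prod_topology Y Z) ?P"
    using openin_continuous_map_preimage assms by blast
  moreover have "(x, y) \<in> ?P"
    using assms by simp
  ultimately obtain U V where uv: "openin Y U" "openin Z V" "x \<in> U" "y \<in> V" "U \<times> V \<subseteq> ?P"
    unfolding openin_prod_topology_alt by meson
  have "f x y \<in> G" if "x \<in> U" "y \<in> V" for x y
    using uv(5) that by auto
  then show thesis
    using that uv by meson
qed

locale pseudocompact_MV_algebra = topological_MV_algebra +
  assumes pseudocompact: "pseudocompact_space X"
begin

lemma continuous_minus: "continuous_map (prod_topology X X) X (\<lambda>(x, y). x \<ominus> y)"
proof -
  have "continuous_map (prod_topology X X) X (\<lambda>z. neg (fst z))"
    using continuous_map_compose[OF continuous_map_fst continuous_neg] by (simp add: o_def)
  then have "continuous_map (prod_topology X X) (prod_topology X X) (\<lambda>z. (neg (fst z), snd z))"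
    by (simp add: continuous_map_pairwise o_def continuous_map_snd)
  then have "continuous_map (prod_topology X X) X ((\<lambda>(x, y). x \<oplus> y) \<circ> (\<lambda>z. (neg (fst z), snd z)))"
    using continuous_map_compose continuous_plus by blast
  then have "continuous_map (prod_topology X X) X
      (neg \<circ> ((\<lambda>(x, y). x \<oplus> y) \<circ> (\<lambda>z. (neg (fst z), snd z))))"
    using continuous_map_compose continuous_neg by blast
  then show ?thesis
    by (simp add: o_def case_prod_unfold minus_def)
qed

lemma continuous_map_mv_plus:
  assumes "continuous_map Z X f" "continuous_map Z X g"
  shows "continuous_map Z X (\<lambda>z. f z \<oplus> g z)"
proof -
  have "continuous_map Z (prod_topology X X) (\<lambda>z. (f z, g z))"
    using assms by (simp add: continuous_map_pairwise o_def)
  from continuous_map_compose[OF this continuous_plus] show ?thesis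
    by (simp add: o_def)
qed

lemma continuous_map_mv_minus:
  assumes "continuous_map Z X f" "continuous_map Z X g"
  shows "continuous_map Z X (\<lambda>z. f z \<ominus> g z)"
proof -
  have "continuous_map Z (prod_topology X X) (\<lambda>z. (f z, g z))"
    using assms by (simp add: continuous_map_pairwise o_def)
  from continuous_map_compose[OF this continuous_minus] show ?thesis
    by (simp add: o_def)
qed

text \<open>Continuity at zero gives no control over elements lying below small ones. If such
  elements \<open>b\<close> could always be found outside \<open>G\<close>, then
  \<open>b \<ominus> s\<close> would be outside \<open>G\<close> for \<open>s = zero\<close> but
  equal to zero as soon as \<open>s\<close> dominates \<open>b\<close>. The double limit criterion,
  applied once from each side, excludes this contrast.\<close>

lemma zero_nbhd_contains_down_set:
  assumes G: "openin X G" "zero \<in> G"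
  shows "\<exists>V. openin X V \<and> zero \<in> V \<and> (\<forall>a\<in>V. \<forall>b\<in>topspace X. b \<sqsubseteq> a \<longrightarrow> b \<in> G)"
proof (rule ccontr)
  assume neg: "\<not> ?thesis"
  define B where "B V = {b \<in> topspace X - G. \<exists>a\<in>V. b \<sqsubseteq> a}" for V
  have GX: "G \<subseteq> topspace X"
    using G openin_subset by blast
  have Bne: "B V \<noteq> {}" if "openin X V" "zero \<in> V" for V
    using neg that unfolding B_def by blast
  have Bmono: "B V \<subseteq> B V'" if "V \<subseteq> V'" for V V'
    using that unfolding B_def by blast
  obtain \<phi> where \<phi>: "continuous_map X euclideanreal \<phi>" "\<phi> zero = 0"
    and \<phi>1: "\<And>x. \<lbrakk>x \<in> topspace X; x \<notin> G\<rbrakk> \<Longrightarrow> \<phi> x = 1"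
    using pseudocompact G unfolding pseudocompact_space_def Tychonoff_space_def
      completely_regular_space_alt' image_subset_iff by (metis DiffI singletonD)
  define f where "f b s = \<phi> (b \<ominus> s)" for b s
  have cf: "continuous_map (prod_topology X X) euclideanreal (\<lambda>(x, y). f x y)"
    using continuous_map_compose[OF continuous_minus \<phi>(1)]
    by (simp add: f_def o_def case_prod_unfold)
  have f1: "continuous_map X euclideanreal (\<lambda>x. f x y)" if "y \<in> topspace X" for y
    using continuous_map_compose[OF continuous_map_mv_minus \<phi>(1), of X "\<lambda>x. x" "\<lambda>x. y"] that
    by (simp add: f_def o_def)
  have f2: "continuous_map X euclideanreal (f x)" if "x \<in> topspace X" for x
    using continuous_map_compose[OF continuous_map_mv_minus \<phi>(1), of X "\<lambda>y. x" "\<lambda>x. x"] that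
    by (simp add: f_def[abs_def] o_def)
  have f_zero: "f b zero = 1" if "b \<in> B V" for b V
    using that by (simp add: f_def B_def minus_zero \<phi>1)
  have f_above: "f b s = 0" if "b \<sqsubseteq> s" "b \<in> topspace X" "s \<in> topspace X" for b s
    using that by (simp add: f_def minus_eq_zero \<phi>)

  txt \<open>Some neighbourhood \<open>V0\<close> of zero is good for every finite set of shifts.  Otherwise \<open>f\<close> would be
    near 1 on products \<open>U n \<times> W (Suc n)\<close> while \<open>f (b n)\<close> drops below 1/2 on earlier finite sets.\<close>

  have "\<exists>V0. openin X V0 \<and> zero \<in> V0 \<and> (\<forall>F V. finite F \<and> F \<subseteq> V0 \<and> openin X V \<and> zero \<in> V \<longrightarrow>
    (\<exists>b\<in>B V. \<forall>s\<in>F. 1/2 < f b s))"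
  proof (rule ccontr)
    assume "\<not> ?thesis"
    then have step: "\<exists>F V. finite F \<and> F \<subseteq> W \<and> openin X V \<and> zero \<in> V \<and>
        (\<forall>b\<in>B V. \<exists>s\<in>F. f b s \<le> 1/2)" if "openin X W" "zero \<in> W" for W
      using that by (simp add: not_less)
    \<comment> \<open>One stage of a recursion, packed into a tuple for dependent choice.
      \<open>Q\<close> hands \<open>W'\<close> on as the next \<open>W\<close> and lets
      \<open>V\<close> decrease, so that a later \<open>b\<close> also fails on every earlier
      \<open>F\<close>.\<close>
    define P where "P = (\<lambda>(W, V, F, b, U, W').
      openin X W \<and> zero \<in> W \<and> openin X V \<and> zero \<in> V \<and> finite F \<and> F \<subseteq> W \<and>
      (\<forall>b\<in>B V. \<exists>s\<in>F. f b s \<le> 1/2) \<and> b \<in> B V \<and> openin X U \<and> b \<in> U \<and>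
      openin X W' \<and> zero \<in> W' \<and> W' \<subseteq> W \<and> (\<forall>x\<in>U. \<forall>y\<in>W'. 9/10 < f x y))"
    define Q where "Q = (\<lambda>(W :: 'a set, V :: 'a set, F :: 'a set, b :: 'a, U :: 'a set, W' :: 'a set)
      (X1, V1, F1 :: 'a set, b1 :: 'a, U1 :: 'a set, X2 :: 'a set). X1 = W' \<and> V1 \<subseteq> V)"
    have ex: "\<exists>V F b U W'. P (W, V, F, b, U, W') \<and> V \<subseteq> V0"
      if W: "openin X W" "zero \<in> W" and V0: "openin X V0" "zero \<in> V0" for W V0
    proof -
      obtain F V where FV: "finite F" "F \<subseteq> W" "openin X V" "zero \<in> V"
        "\<forall>b\<in>B V. \<exists>s\<in>F. f b s \<le> 1/2"
        using step[OF W] by blast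
      have V1: "openin X (V \<inter> V0)" "zero \<in> V \<inter> V0"
        using FV V0 by auto
      obtain b where b: "b \<in> B (V \<inter> V0)"
        using Bne[OF V1] by blast
      then have bX: "b \<in> topspace X"
        by (simp add: B_def)
      \<comment> \<open>The value is 1; any level strictly between 1/2 and 1 would serve.\<close>
      have "f b zero \<in> {9/10<..}"
        using f_zero[OF b] by simp
      then obtain U W' where "openin X U" "openin X W'" "b \<in> U" "zero \<in> W'"
        "\<And>x y. \<lbrakk>x \<in> U; y \<in> W'\<rbrakk> \<Longrightarrow> f x y \<in> {9/10<..}"
        using continuous_map_prod_nbhd[OF cf _ bX zero_closed, of "{9/10<..}"] by auto
      then have "P (W, V \<inter> V0, F, b, U, W' \<inter> W)"
        unfolding P_def using W FV V1 b Bmono[of "V \<inter> V0" V] by auto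
      then show ?thesis
        by blast
    qed
    have ex0: "\<exists>\<sigma>. P \<sigma>"
      using ex[of "topspace X" "topspace X"] zero_closed by blast
    have ex1: "\<exists>\<tau>. P \<tau> \<and> Q \<sigma> \<tau>" if "P \<sigma>" for \<sigma>
    proof -
      obtain W V F b U W' where \<sigma>: "\<sigma> = (W, V, F, b, U, W')"
        by (metis prod.exhaust)
      then have "openin X W'" "zero \<in> W'" "openin X V" "zero \<in> V"
        using that unfolding P_def by auto
      from ex[OF this] show ?thesis
        unfolding \<sigma> Q_def by fast
    qed
    obtain \<sigma> where \<sigma>: "\<And>n. P (\<sigma> n)" "\<And>n. Q (\<sigma> n) (\<sigma> (Suc n))"
      using dependent_nat_choice[of "\<lambda>n. P" "\<lambda>n. Q"] ex0 ex1 by metis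
    have "\<exists>W V F b U W'. \<forall>n. \<sigma> n = (W n, V n, F n, b n, U n, W' n)"
      by (rule exI[of _ "\<lambda>n. fst (\<sigma> n)"], rule exI[of _ "\<lambda>n. fst (snd (\<sigma> n))"],
          rule exI[of _ "\<lambda>n. fst (snd (snd (\<sigma> n)))"],
          rule exI[of _ "\<lambda>n. fst (snd (snd (snd (\<sigma> n))))"],
          rule exI[of _ "\<lambda>n. fst (snd (snd (snd (snd (\<sigma> n)))))"],
          rule exI[of _ "\<lambda>n. snd (snd (snd (snd (snd (\<sigma> n)))))"]) simp
    then obtain W V F b U W' where eq: "\<And>n. \<sigma> n = (W n, V n, F n, b n, U n, W' n)"
      by blast
    have p: "openin X (W n)" "finite (F n)" "F n \<subseteq> W n" "b n \<in> B (V n)" "openin X (U n)" "b n \<in> U n"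
      "W' n \<subseteq> W n" and p1: "\<And>b. b \<in> B (V n) \<Longrightarrow> \<exists>s\<in>F n. f b s \<le> 1/2"
      and p2: "\<And>x y. \<lbrakk>x \<in> U n; y \<in> W' n\<rbrakk> \<Longrightarrow> 9/10 < f x y" for n
      using \<sigma>(1)[of n] unfolding eq P_def by auto
    have q: "W (Suc n) = W' n" "V (Suc n) \<subseteq> V n" for n
      using \<sigma>(2)[of n] unfolding eq Q_def by auto
    have Vd: "V n \<subseteq> V m" if "m \<le> n" for m n
      using q(2) lift_Suc_antimono_le that by metis
    \<comment> \<open>The criterion wants small values on products and large ones at chosen points;
      here it is the other way round, hence \<open>- f\<close>.\<close>
    have "- (1/2) \<le> - (9/10 :: real)"
    proof (rule pseudocompact_double_limit[OF pseudocompact pseudocompact,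
          where f = "\<lambda>x y. - f x y" and U = U and W = W and x = b and F = F])
      show "\<exists>y\<in>F m. - (1/2) \<le> - f (b n) y" if "m \<le> n" for m n
        using p1[of "b n" m] p(4)[of n] Bmono[OF Vd[OF that]] by (auto simp: subset_iff)
      show "- f x y \<le> - (9/10)" if "x \<in> U n" "y \<in> W (Suc n)" for x y n
        using p2[of x n y] that q by simp
    qed (use p q f1 f2 in \<open>auto intro!: continuous_map_minus\<close>)
    then show False
      by simp
  qed
  then obtain V0 where V0: "openin X V0" "zero \<in> V0"
    and V0_ex: "\<And>F V. \<lbrakk>finite F; F \<subseteq> V0; openin X V; zero \<in> V\<rbrakk> \<Longrightarrow> \<exists>b\<in>B V. \<forall>s\<in>F. 1/2 < f b s"
    by metis

  txt \<open>Shifts \<open>s n\<close> inside \<open>V0\<close>, each dominating the preceding witness \<open>b\<close>, give the opposite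
    pattern: \<open>f\<close> is near 0 on \<open>U n \<times> W (Suc n)\<close> and \<open>f (b n)\<close> exceeds 1/2 at all earlier shifts.\<close>

  \<comment> \<open>\<open>F\<close> accumulates the shifts: each new \<open>b\<close> is tested
    against all of them, while dependent choice sees only the previous stage.\<close>
  define P where "P = (\<lambda>(W, s, F, b, U, W'). openin X W \<and> s \<in> W \<and> W \<subseteq> V0 \<and> finite F \<and> F \<subseteq> V0 \<and>
    s \<in> F \<and> openin X U \<and> b \<in> U \<and> (\<forall>t\<in>F. 1/2 < f b t) \<and> openin X W' \<and> W' \<noteq> {} \<and> W' \<subseteq> W \<and>
    (\<forall>x\<in>U. \<forall>y\<in>W'. f x y < 1/4))"
  define Q where "Q = (\<lambda>(W :: 'a set, s :: 'a, F :: 'a set, b :: 'a, U :: 'a set, W' :: 'a set)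
    (W1, s1 :: 'a, F1 :: 'a set, b1 :: 'a, U1 :: 'a set, W1' :: 'a set). W1 = W' \<and> F \<subseteq> F1)"
  have ex: "\<exists>s F b U W'. P (W, s, F, b, U, W') \<and> F0 \<subseteq> F"
    if W: "openin X W" "W \<noteq> {}" "W \<subseteq> V0" and F0: "finite F0" "F0 \<subseteq> V0" for W F0
  proof -
    obtain s where s: "s \<in> W"
      using W by blast
    then have sX: "s \<in> topspace X"
      using W openin_subset by blast
    \<comment> \<open>Pulling \<open>W\<close> back along translation by \<open>s\<close> provides a
      point \<open>s \<oplus> a\<close> that stays in \<open>W\<close> and dominates
      \<open>b\<close>, as \<open>b \<sqsubseteq> a \<sqsubseteq> s \<oplus> a\<close>.\<close>
    let ?V = "{a \<in> topspace X. s \<oplus> a \<in> W}" and ?F = "insert s F0"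
    have V: "openin X ?V" "zero \<in> ?V"
      using openin_continuous_map_preimage[OF continuous_map_mv_plus W(1), of X "\<lambda>a. s" "\<lambda>a. a"]
        sX s by (simp_all add: zero_closed plus_zero)
    obtain b where b: "b \<in> B ?V" "\<And>t. t \<in> ?F \<Longrightarrow> 1/2 < f b t"
      using V0_ex[of ?F ?V] F0 V s W by blast
    then obtain a where a: "a \<in> topspace X" "s \<oplus> a \<in> W" "b \<sqsubseteq> a" and bX: "b \<in> topspace X"
      unfolding B_def by blast
    have "b \<sqsubseteq> s \<oplus> a"
      using a(3) le_plus2[OF sX a(1)] by (rule le_trans) (use a sX bX in \<open>simp_all add: closed\<close>)
    then have "f b (s \<oplus> a) \<in> {..<1/4}"
      using f_above[of b "s \<oplus> a"] a sX bX by (simp add: closed)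
    then obtain U W' where "openin X U" "openin X W'" "b \<in> U" "s \<oplus> a \<in> W'"
      "\<And>x y. \<lbrakk>x \<in> U; y \<in> W'\<rbrakk> \<Longrightarrow> f x y \<in> {..<1/4}"
      using continuous_map_prod_nbhd[OF cf _ bX plus_closed[OF sX a(1)], of "{..<1/4}"] by auto
    then have "P (W, s, ?F, b, U, W' \<inter> W)"
      unfolding P_def using W s F0 b(2) a(2) by auto
    then show ?thesis
      by blast
  qed
  have ex0: "\<exists>\<sigma>. P \<sigma>"
    using ex[of V0 "{}"] V0 by blast
  have ex1: "\<exists>\<tau>. P \<tau> \<and> Q \<sigma> \<tau>" if "P \<sigma>" for \<sigma>
  proof -
    obtain W s F b U W' where \<sigma>: "\<sigma> = (W, s, F, b, U, W')"
      by (metis prod.exhaust)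
    then have "openin X W'" "W' \<noteq> {}" "W' \<subseteq> V0" "finite F" "F \<subseteq> V0"
      using that unfolding P_def by auto
    from ex[OF this] show ?thesis
      unfolding \<sigma> Q_def by fast
  qed
  obtain \<sigma> where \<sigma>: "\<And>n. P (\<sigma> n)" "\<And>n. Q (\<sigma> n) (\<sigma> (Suc n))"
    using dependent_nat_choice[of "\<lambda>n. P" "\<lambda>n. Q"] ex0 ex1 by metis
  have "\<exists>W s F b U W'. \<forall>n. \<sigma> n = (W n, s n, F n, b n, U n, W' n)"
    by (rule exI[of _ "\<lambda>n. fst (\<sigma> n)"], rule exI[of _ "\<lambda>n. fst (snd (\<sigma> n))"],
        rule exI[of _ "\<lambda>n. fst (snd (snd (\<sigma> n)))"],
        rule exI[of _ "\<lambda>n. fst (snd (snd (snd (\<sigma> n))))"],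
        rule exI[of _ "\<lambda>n. fst (snd (snd (snd (snd (\<sigma> n)))))"],
        rule exI[of _ "\<lambda>n. snd (snd (snd (snd (snd (\<sigma> n)))))"]) simp
  then obtain W s F b U W' where eq: "\<And>n. \<sigma> n = (W n, s n, F n, b n, U n, W' n)"
    by blast
  have p: "openin X (W n)" "s n \<in> W n" "s n \<in> F n" "openin X (U n)" "b n \<in> U n" "W' n \<subseteq> W n"
    and p1: "\<And>t. t \<in> F n \<Longrightarrow> 1/2 < f (b n) t"
    and p2: "\<And>x y. \<lbrakk>x \<in> U n; y \<in> W' n\<rbrakk> \<Longrightarrow> f x y < 1/4" for n
    using \<sigma>(1)[of n] unfolding eq P_def by auto
  have q: "W (Suc n) = W' n" "F n \<subseteq> F (Suc n)" for n
    using \<sigma>(2)[of n] unfolding eq Q_def by auto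
  have Fm: "F m \<subseteq> F n" if "m \<le> n" for m n
    using q(2) lift_Suc_mono_le that by metis
  have "1/2 \<le> (1/4 :: real)"
  proof (rule pseudocompact_double_limit[OF pseudocompact pseudocompact,
        where f = f and U = U and W = W and x = b and F = "\<lambda>n. {s n}"])
    show "\<exists>y\<in>{s m}. 1/2 \<le> f (b n) y" if "m \<le> n" for m n
      using p1[of "s m" n] p(3)[of m] Fm[OF that] by auto
    show "f x y \<le> 1/4" if "x \<in> U n" "y \<in> W (Suc n)" for x y n
      using p2[of x n y] that q by simp
  qed (use p q f1 f2 in auto)
  then show False
    by simp
qed

end

section \<open>The uniformity of a pseudocompact MV-algebra\<close>

context pseudocompact_MV_algebra
begin

text \<open>The radii of the uniformity. Down-closedness turns the order bound of the triangle
  inequality into membership.\<close>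

definition solid_nbhd :: "'a set \<Rightarrow> bool" where
  "solid_nbhd S \<longleftrightarrow> S \<subseteq> topspace X \<and> (\<forall>a\<in>S. \<forall>b\<in>topspace X. b \<sqsubseteq> a \<longrightarrow> b \<in> S) \<and>
     (\<exists>V. openin X V \<and> zero \<in> V \<and> V \<subseteq> S)"

lemma solid_nbhdD:
  assumes "solid_nbhd S"
  shows "S \<subseteq> topspace X" "zero \<in> S" "\<And>a b. \<lbrakk>a \<in> S; b \<in> topspace X; b \<sqsubseteq> a\<rbrakk> \<Longrightarrow> b \<in> S"
    "\<exists>V. openin X V \<and> zero \<in> V \<and> V \<subseteq> S"
proof -
  show "S \<subseteq> topspace X" and V: "\<exists>V. openin X V \<and> zero \<in> V \<and> V \<subseteq> S"
    using assms by (simp_all add: solid_nbhd_def)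
  from V show "zero \<in> S"
    by blast
  show "b \<in> S" if "a \<in> S" "b \<in> topspace X" "b \<sqsubseteq> a" for a b
    using assms that by (simp add: solid_nbhd_def)
qed

lemma solid_nbhd_Int:
  assumes "solid_nbhd S" "solid_nbhd T"
  shows "solid_nbhd (S \<inter> T)"
proof -
  obtain V W where "openin X V" "zero \<in> V" "V \<subseteq> S" "openin X W" "zero \<in> W" "W \<subseteq> T"
    using assms solid_nbhdD(4) by metis
  then have "openin X (V \<inter> W) \<and> zero \<in> V \<inter> W \<and> V \<inter> W \<subseteq> S \<inter> T"
    by auto
  then show ?thesis
    using assms unfolding solid_nbhd_def by blast
qed

lemma solid_nbhd_topspace: "solid_nbhd (topspace X)"
  unfolding solid_nbhd_def using openin_topspace[of X] zero_closed by blast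

lemma solid_nbhd_in_open:
  assumes "openin X G" "zero \<in> G"
  shows "\<exists>S. solid_nbhd S \<and> S \<subseteq> G"
proof -
  obtain V where V: "openin X V" "zero \<in> V" "\<forall>a\<in>V. \<forall>b\<in>topspace X. b \<sqsubseteq> a \<longrightarrow> b \<in> G"
    using zero_nbhd_contains_down_set[OF assms] by blast
  let ?S = "{b \<in> topspace X. \<exists>a\<in>V. b \<sqsubseteq> a}"
  have VX: "V \<subseteq> topspace X"
    using V openin_subset by blast
  have "b \<in> ?S" if a: "a \<in> ?S" "b \<in> topspace X" "b \<sqsubseteq> a" for a b
  proof -
    obtain c where "c \<in> V" "a \<sqsubseteq> c" "a \<in> topspace X"
      using a(1) by blast
    then show ?thesis
      using le_trans[of b a c] a(2,3) VX by blast
  qed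
  moreover have "V \<subseteq> ?S"
    using VX le_refl by blast
  ultimately have "solid_nbhd ?S"
    unfolding solid_nbhd_def using V(1,2) by blast
  then show ?thesis
    using V(3) by (intro exI[of _ ?S]) blast
qed

text \<open>Continuity of the sum at \<open>(zero, zero)\<close>; this is the halving axiom of a
  uniformity.\<close>

lemma solid_nbhd_half:
  assumes "solid_nbhd S"
  shows "\<exists>T. solid_nbhd T \<and> (\<forall>a\<in>T. \<forall>b\<in>T. a \<oplus> b \<in> S)"
proof -
  obtain V where V: "openin X V" "zero \<in> V" "V \<subseteq> S"
    using solid_nbhdD[OF assms] by blast
  then have "zero \<oplus> zero \<in> V"
    by (simp add: plus_zero zero_closed)
  then obtain U W where UW: "openin X U" "openin X W" "zero \<in> U" "zero \<in> W"
    "\<And>x y. \<lbrakk>x \<in> U; y \<in> W\<rbrakk> \<Longrightarrow> x \<oplus> y \<in> V"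
    using continuous_map_prod_nbhd[OF continuous_plus V(1) zero_closed zero_closed] by metis
  then obtain T where "solid_nbhd T" "T \<subseteq> U \<inter> W"
    using solid_nbhd_in_open[of "U \<inter> W"] by auto
  then show ?thesis
    using UW(5) V(3) by blast
qed

section \<open>Distance balls and the topology\<close>

lemma solid_nbhd_dist_trans:
  assumes "solid_nbhd S" "mv_dist x y \<in> T" "mv_dist y z \<in> T" "\<forall>a\<in>T. \<forall>b\<in>T. a \<oplus> b \<in> S"
    and X: "x \<in> topspace X" "y \<in> topspace X" "z \<in> topspace X"
  shows "mv_dist x z \<in> S"
proof -
  have "mv_dist x y \<oplus> mv_dist y z \<in> S"
    using assms(2-4) by blast
  then show ?thesis
    using solid_nbhdD(3)[OF assms(1)] mv_dist_triangle[OF X] mv_dist_closed[OF X(1,3)] by blast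
qed

text \<open>The distance to \<open>x\<close> is continuous and vanishes at \<open>x\<close>. With
  \<open>open_contains_dist_ball\<close>, the balls around \<open>x\<close> form a base of its
  neighbourhoods.\<close>

lemma dist_ball_nbhd:
  assumes "solid_nbhd S" "x \<in> topspace X"
  shows "\<exists>G. openin X G \<and> x \<in> G \<and> (\<forall>y\<in>G. mv_dist x y \<in> S)"
proof -
  obtain V where V: "openin X V" "zero \<in> V" "V \<subseteq> S"
    using solid_nbhdD[OF assms(1)] by blast
  let ?G = "{y \<in> topspace X. mv_dist x y \<in> V}"
  have "continuous_map X X (\<lambda>y. mv_dist x y)"
    unfolding mv_dist_def using assms(2)
    by (intro continuous_map_mv_plus continuous_map_mv_minus) auto
  then have "openin X ?G"
    using V(1) openin_continuous_map_preimage by blast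
  moreover have "x \<in> ?G"
    using assms(2) V(2) by (simp add: mv_dist_self)
  ultimately show ?thesis
    using V(3) by (intro exI[of _ ?G]) blast
qed

text \<open>A point \<open>y\<close> is recovered from \<open>x\<close> and the two differences as \<open>(x - (x - y)) + (y - x)\<close>.\<close>

lemma open_contains_dist_ball:
  assumes G: "openin X G" "x \<in> G"
  shows "\<exists>S. solid_nbhd S \<and> (\<forall>y\<in>topspace X. mv_dist x y \<in> S \<longrightarrow> y \<in> G)"
proof -
  have x: "x \<in> topspace X"
    using G openin_subset by blast
  have fst: "continuous_map (prod_topology X X) X (\<lambda>z. fst z)"
    and snd: "continuous_map (prod_topology X X) X (\<lambda>z. snd z)"
    using continuous_map_fst continuous_map_snd by auto
  have "continuous_map (prod_topology X X) X (\<lambda>z. (x \<ominus> fst z) \<oplus> snd z)"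
    using x by (intro continuous_map_mv_plus continuous_map_mv_minus fst snd) auto
  then have c: "continuous_map (prod_topology X X) X (\<lambda>(s, t). (x \<ominus> s) \<oplus> t)"
    by (simp add: case_prod_unfold)
  have "(x \<ominus> zero) \<oplus> zero \<in> G"
    using G x by (simp add: minus_zero plus_zero)
  then obtain U W where UW: "openin X U" "openin X W" "zero \<in> U" "zero \<in> W"
    "\<And>s t. \<lbrakk>s \<in> U; t \<in> W\<rbrakk> \<Longrightarrow> (x \<ominus> s) \<oplus> t \<in> G"
    using continuous_map_prod_nbhd[OF c G(1) zero_closed zero_closed] by metis
  then obtain T where T: "solid_nbhd T" "T \<subseteq> U \<inter> W"
    using solid_nbhd_in_open[of "U \<inter> W"] by auto
  have "y \<in> G" if y: "y \<in> topspace X" "mv_dist x y \<in> T" for y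
  proof -
    have "x \<ominus> y \<in> T" "y \<ominus> x \<in> T"
      using solid_nbhdD(3)[OF T(1) y(2)] x y(1) le_plus le_plus2
      by (auto simp: mv_dist_def closed)
    then have "(x \<ominus> (x \<ominus> y)) \<oplus> (y \<ominus> x) \<in> G"
      using T(2) UW(5) by blast
    then show ?thesis
      using x y(1) by (simp add: meet_plus_minus)
  qed
  then show ?thesis
    using T(1) by blast
qed

text \<open>Pseudocompactness yields cluster points of open sets, not of points; hence the
  intermediate \<open>y\<close>, close to both \<open>z\<close> and \<open>x n\<close>.\<close>

lemma cluster_point_of_balls:
  assumes T: "\<And>n. solid_nbhd (T n)" and x: "\<And>n::nat. x n \<in> topspace X"
  shows "\<exists>z\<in>topspace X. \<forall>S N. solid_nbhd S \<longrightarrow>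
    (\<exists>n\<ge>N. \<exists>y\<in>topspace X. mv_dist z y \<in> S \<and> mv_dist (x n) y \<in> T n)"
proof -
  have "\<forall>n. \<exists>G. openin X G \<and> x n \<in> G \<and> (\<forall>y\<in>G. mv_dist (x n) y \<in> T n)"
    using dist_ball_nbhd T x by blast
  then obtain G where G: "\<And>n. openin X (G n)" "\<And>n. x n \<in> G n"
    "\<And>n. \<forall>y\<in>G n. mv_dist (x n) y \<in> T n"
    by metis
  have ne: "G n \<noteq> {}" for n
    using G(2) by blast
  obtain z where z: "z \<in> topspace X"
    and zG: "\<forall>H N. openin X H \<and> z \<in> H \<longrightarrow> (\<exists>n\<ge>N. H \<inter> G n \<noteq> {})"
    using pseudocompact_cluster_point[of X G, OF pseudocompact G(1) ne] by blast
  have "\<exists>n\<ge>N. \<exists>y\<in>topspace X. mv_dist z y \<in> S \<and> mv_dist (x n) y \<in> T n"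
    if S: "solid_nbhd S" for S N
  proof -
    obtain H where H: "openin X H" "z \<in> H" "\<forall>y\<in>H. mv_dist z y \<in> S"
      using dist_ball_nbhd[OF S z] by blast
    then obtain n y where "n \<ge> N" "y \<in> H" "y \<in> G n"
      using zG by blast
    then show ?thesis
      using H G openin_subset by blast
  qed
  then show ?thesis
    using z by blast
qed

section \<open>Uniform continuity of real functions\<close>

lemma halving_sequence_antimono:
  assumes "\<And>k. solid_nbhd (S k)" "\<And>k. \<forall>a\<in>S (Suc k). \<forall>b\<in>S (Suc k). a \<oplus> b \<in> S k" "m \<le> n"
  shows "S n \<subseteq> S m"
proof -
  have "S (Suc k) \<subseteq> S k" for k
  proof
    fix a assume "a \<in> S (Suc k)"
    then have "a \<oplus> zero \<in> S k" "a \<in> topspace X"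
      using assms(2)[of k] solid_nbhdD(1,2)[OF assms(1)[of "Suc k"]] by blast+
    then show "a \<in> S k"
      by (simp add: plus_zero)
  qed
  then show ?thesis
    using lift_Suc_antimono_le assms(3) by metis
qed

text \<open>A cluster point \<open>u\<close> of small balls about bad points \<open>w k\<close> is equivalent to \<open>z\<close> modulo the
  intersection of the \<open>S k\<close>, and \<open>z - u + w k\<close> shows that some \<open>w k\<close> is not bad.\<close>

lemma near_modulo_halving_sequence:
  assumes S: "\<And>k. solid_nbhd (S k)" and half: "\<And>k. \<forall>a\<in>S (Suc k). \<forall>b\<in>S (Suc k). a \<oplus> b \<in> S k"
    and z: "z \<in> topspace X" and P: "solid_nbhd P"
  shows "\<exists>k. \<forall>w\<in>topspace X. mv_dist z w \<in> S k \<longrightarrow>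
    (\<exists>v\<in>topspace X. mv_dist v z \<in> P \<and> (\<forall>j. mv_dist v w \<in> S j))"
proof (rule ccontr)
  assume "\<not> ?thesis"
  then have "\<forall>k. \<exists>w. w \<in> topspace X \<and> mv_dist z w \<in> S k \<and>
      (\<forall>v\<in>topspace X. mv_dist v z \<in> P \<longrightarrow> (\<exists>j. mv_dist v w \<notin> S j))"
    by blast
  then obtain w where w: "\<And>k. w k \<in> topspace X" "\<And>k. mv_dist z (w k) \<in> S k"
    and bad: "\<And>k. \<forall>v\<in>topspace X. mv_dist v z \<in> P \<longrightarrow> (\<exists>j. mv_dist v (w k) \<notin> S j)"
    by metis
  have anti: "S n \<subseteq> S m" if "m \<le> n" for m n
    using halving_sequence_antimono[of S m n] S half that by blast
  obtain Q where Q: "solid_nbhd Q" "\<forall>a\<in>Q. \<forall>b\<in>Q. a \<oplus> b \<in> P"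
    using solid_nbhd_half[OF P] by blast
  \<comment> \<open>The radius serves two purposes: \<open>S n\<close> ties \<open>u\<close> to
    \<open>z\<close>, and \<open>Q\<close> brings some \<open>w n\<close> within \<open>P\<close> of
    \<open>u\<close>.\<close>
  obtain u where u: "u \<in> topspace X" and near: "\<forall>T N. solid_nbhd T \<longrightarrow>
      (\<exists>n\<ge>N. \<exists>y\<in>topspace X. mv_dist u y \<in> T \<and> mv_dist (w n) y \<in> Q \<inter> S n)"
    using cluster_point_of_balls[of "\<lambda>n. Q \<inter> S n" w] solid_nbhd_Int[OF Q(1) S] w(1) by blast
  \<comment> \<open>Two triangle inequalities, through \<open>y\<close> and then through
    \<open>w n\<close>, cost one index each.\<close>
  have zu: "mv_dist z u \<in> S j" for j
  proof -
    obtain n y where n: "n \<ge> Suc (Suc j)" and y: "y \<in> topspace X" "mv_dist u y \<in> S (Suc (Suc j))"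
      "mv_dist (w n) y \<in> S n"
      using near S by blast
    have "mv_dist (w n) y \<in> S (Suc (Suc j))" "mv_dist y u \<in> S (Suc (Suc j))"
      using y n anti u mv_dist_commute by auto
    then have "mv_dist (w n) u \<in> S (Suc j)"
      using solid_nbhd_dist_trans[OF S _ _ half] w(1) y(1) u by blast
    moreover have "mv_dist z (w n) \<in> S (Suc j)"
      using w(2)[of n] anti[of "Suc j" n] n by auto
    ultimately show ?thesis
      using solid_nbhd_dist_trans[OF S _ _ half] w(1) z u by blast
  qed
  obtain n y where y: "y \<in> topspace X" "mv_dist u y \<in> Q" "mv_dist (w n) y \<in> Q"
    using near Q(1) by blast
  have "mv_dist y (w n) \<in> Q"
    using y(1,3) w(1)[of n] mv_dist_commute by simp
  then have "mv_dist u (w n) \<in> P"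
    by (rule solid_nbhd_dist_trans[OF P y(2) _ Q(2) u y(1) w(1)])
  moreover obtain v where v: "v \<in> topspace X" "mv_dist v z \<sqsubseteq> mv_dist u (w n)"
    "mv_dist v (w n) \<sqsubseteq> mv_dist z u"
    using mv_dist_translate[OF w(1)[of n] u z] by blast
  ultimately have "mv_dist v z \<in> P"
    using solid_nbhdD(3)[OF P] mv_dist_closed z by blast
  moreover have "mv_dist v (w n) \<in> S j" for j
    using solid_nbhdD(3)[OF S zu[of j] _ v(3)] mv_dist_closed v(1) w(1) by blast
  ultimately show False
    using bad[of n] v(1) by blast
qed

text \<open>A sequence of counterexamples \<open>(x n, y n)\<close> comes \<open>S k\<close>-close
  to a cluster point \<open>z\<close>, but the ball around \<open>z\<close> on which
  \<open>\<phi>\<close> is nearly constant need not contain any \<open>S k\<close>-ball.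
  \<open>near_modulo_halving_sequence\<close> replaces \<open>x n\<close> and \<open>y n\<close> by
  points inside that ball, equivalent to them modulo all \<open>S j\<close>.\<close>

lemma uniformly_continuous_real:
  assumes \<phi>: "continuous_map X euclideanreal \<phi>" and \<epsilon>: "0 < \<epsilon>"
  shows "\<exists>S. solid_nbhd S \<and>
    (\<forall>x\<in>topspace X. \<forall>y\<in>topspace X. mv_dist x y \<in> S \<longrightarrow> \<bar>\<phi> x - \<phi> y\<bar> < \<epsilon>)"
proof (rule ccontr)
  assume neg: "\<not> ?thesis"
  have near_pt: "\<exists>S. solid_nbhd S \<and> (\<forall>y\<in>topspace X. mv_dist x y \<in> S \<longrightarrow> \<bar>\<phi> x - \<phi> y\<bar> < \<delta>)"
    if x: "x \<in> topspace X" and "0 < \<delta>" for x \<delta>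
  proof -
    let ?G = "{y \<in> topspace X. \<phi> y \<in> ball (\<phi> x) \<delta>}"
    have "openin X ?G"
      using openin_continuous_map_preimage[OF \<phi>] open_openin by blast
    moreover have "x \<in> ?G"
      using that by simp
    ultimately obtain S where "solid_nbhd S" "\<forall>y\<in>topspace X. mv_dist x y \<in> S \<longrightarrow> y \<in> ?G"
      using open_contains_dist_ball by blast
    then show ?thesis
      by (auto simp: dist_real_def)
  qed
  define P where "P = (\<lambda>(S, x, y). solid_nbhd S \<and> x \<in> topspace X \<and> y \<in> topspace X \<and>
    mv_dist x y \<in> S \<and> \<epsilon> \<le> \<bar>\<phi> x - \<phi> y\<bar>)"
  \<comment> \<open>The next radius is chosen after \<open>x\<close> and \<open>y\<close>, so that
    \<open>\<phi>\<close> barely changes between either of them and a point equivalent to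
    it.\<close>
  define Q where "Q = (\<lambda>(S :: 'a set, x, y) (T, x' :: 'a, y' :: 'a). (\<forall>a\<in>T. \<forall>b\<in>T. a \<oplus> b \<in> S) \<and>
    (\<forall>u\<in>topspace X. mv_dist x u \<in> T \<longrightarrow> \<bar>\<phi> x - \<phi> u\<bar> < \<epsilon>/4) \<and>
    (\<forall>u\<in>topspace X. mv_dist y u \<in> T \<longrightarrow> \<bar>\<phi> y - \<phi> u\<bar> < \<epsilon>/4))"
  have ex: "\<exists>x y. P (S, x, y)" if "solid_nbhd S" for S
    unfolding P_def using neg that by (simp add: not_less) blast
  have ex0: "\<exists>\<sigma>. P \<sigma>"
    using ex[OF solid_nbhd_topspace] by blast
  have ex1: "\<exists>\<tau>. P \<tau> \<and> Q \<sigma> \<tau>" if "P \<sigma>" for \<sigma>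
  proof -
    obtain S x y where \<sigma>: "\<sigma> = (S, x, y)"
      by (metis prod.exhaust)
    then have S: "solid_nbhd S" "x \<in> topspace X" "y \<in> topspace X"
      using that by (auto simp: P_def)
    obtain T where T: "solid_nbhd T" "\<forall>a\<in>T. \<forall>b\<in>T. a \<oplus> b \<in> S"
      using solid_nbhd_half[OF S(1)] by blast
    obtain Tx where Tx: "solid_nbhd Tx"
      "\<forall>u\<in>topspace X. mv_dist x u \<in> Tx \<longrightarrow> \<bar>\<phi> x - \<phi> u\<bar> < \<epsilon>/4"
      using near_pt[OF S(2), of "\<epsilon>/4"] \<epsilon> by auto
    obtain Ty where Ty: "solid_nbhd Ty"
      "\<forall>u\<in>topspace X. mv_dist y u \<in> Ty \<longrightarrow> \<bar>\<phi> y - \<phi> u\<bar> < \<epsilon>/4"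
      using near_pt[OF S(3), of "\<epsilon>/4"] \<epsilon> by auto
    have "solid_nbhd (T \<inter> (Tx \<inter> Ty))"
      by (intro solid_nbhd_Int T Tx Ty)
    then obtain x' y' where "P (T \<inter> (Tx \<inter> Ty), x', y')"
      using ex by blast
    moreover have "Q \<sigma> (T \<inter> (Tx \<inter> Ty), x', y')"
      unfolding \<sigma> Q_def using T(2) Tx(2) Ty(2) by auto
    ultimately show ?thesis
      by blast
  qed
  obtain \<sigma> where \<sigma>: "\<And>n. P (\<sigma> n)" "\<And>n. Q (\<sigma> n) (\<sigma> (Suc n))"
    using dependent_nat_choice[of "\<lambda>n. P" "\<lambda>n. Q"] ex0 ex1 by metis
  define S where "S n = fst (\<sigma> n)" for n
  define x where "x n = fst (snd (\<sigma> n))" for n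
  define y where "y n = snd (snd (\<sigma> n))" for n
  have eq: "\<sigma> n = (S n, x n, y n)" for n
    by (simp add: S_def x_def y_def)
  have S: "solid_nbhd (S n)" and X: "x n \<in> topspace X" "y n \<in> topspace X"
    and xy: "mv_dist (x n) (y n) \<in> S n" and far: "\<epsilon> \<le> \<bar>\<phi> (x n) - \<phi> (y n)\<bar>" for n
    using \<sigma>(1)[of n] unfolding eq P_def by auto
  have half: "\<forall>a\<in>S (Suc n). \<forall>b\<in>S (Suc n). a \<oplus> b \<in> S n"
    and xn: "\<And>u. \<lbrakk>u \<in> topspace X; mv_dist (x n) u \<in> S (Suc n)\<rbrakk> \<Longrightarrow> \<bar>\<phi> (x n) - \<phi> u\<bar> < \<epsilon>/4"
    and yn: "\<And>u. \<lbrakk>u \<in> topspace X; mv_dist (y n) u \<in> S (Suc n)\<rbrakk> \<Longrightarrow> \<bar>\<phi> (y n) - \<phi> u\<bar> < \<epsilon>/4" for n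
    using \<sigma>(2)[of n] unfolding eq Q_def by auto
  have anti: "S n \<subseteq> S m" if "m \<le> n" for m n
    using halving_sequence_antimono[of S m n] S half that by blast
  obtain z where z: "z \<in> topspace X" and near: "\<forall>T N. solid_nbhd T \<longrightarrow>
      (\<exists>n\<ge>N. \<exists>u\<in>topspace X. mv_dist z u \<in> T \<and> mv_dist (x n) u \<in> S n)"
    using cluster_point_of_balls[of S x] S X by blast
  \<comment> \<open>Twice \<open>\<epsilon>/8\<close> around \<open>z\<close> and
    \<open>\<epsilon>/4\<close> around each of \<open>x n\<close> and \<open>y n\<close> add up to
    less than \<open>\<epsilon>\<close>.\<close>
  obtain T where T: "solid_nbhd T" "\<forall>u\<in>topspace X. mv_dist z u \<in> T \<longrightarrow> \<bar>\<phi> z - \<phi> u\<bar> < \<epsilon>/8"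
    using near_pt[OF z, of "\<epsilon>/8"] \<epsilon> by auto
  obtain k where k: "\<forall>w\<in>topspace X. mv_dist z w \<in> S k \<longrightarrow>
      (\<exists>v\<in>topspace X. mv_dist v z \<in> T \<and> (\<forall>j. mv_dist v w \<in> S j))"
    using near_modulo_halving_sequence[of S z T] S half z T(1) by blast
  \<comment> \<open>Two indices are spent: on reaching \<open>x n\<close> from \<open>z\<close>
    through \<open>u\<close>, and on going from \<open>x n\<close> to \<open>y n\<close>.\<close>
  obtain n u where n: "n \<ge> Suc (Suc k)" and u: "u \<in> topspace X" "mv_dist z u \<in> S (Suc (Suc k))"
    "mv_dist (x n) u \<in> S n"
    using near S by blast
  have "mv_dist u (x n) \<in> S (Suc (Suc k))"
    using u(1,3) X(1)[of n] anti[OF n] mv_dist_commute[of u "x n"] by auto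
  then have zx: "mv_dist z (x n) \<in> S (Suc k)"
    using solid_nbhd_dist_trans[OF S u(2) _ half z u(1) X(1)] by blast
  have "mv_dist (x n) (y n) \<in> S (Suc k)"
    using xy[of n] anti[of "Suc k" n] n by auto
  then have zy: "mv_dist z (y n) \<in> S k"
    using solid_nbhd_dist_trans[OF S zx _ half z X(1) X(2)] by blast
  have near_z: "\<exists>v\<in>topspace X. \<bar>\<phi> z - \<phi> v\<bar> < \<epsilon>/8 \<and> mv_dist w v \<in> S (Suc n)"
    if w: "w \<in> topspace X" "mv_dist z w \<in> S k" for w
  proof -
    obtain v where v: "v \<in> topspace X" "mv_dist v z \<in> T" "mv_dist v w \<in> S (Suc n)"
      using k w by blast
    then show ?thesis
      using T(2) mv_dist_commute[of v z] mv_dist_commute[of v w] z w by auto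
  qed
  obtain v where v: "v \<in> topspace X" "\<bar>\<phi> z - \<phi> v\<bar> < \<epsilon>/8" "mv_dist (x n) v \<in> S (Suc n)"
    using near_z[OF X(1)] zx anti[of k "Suc k"] by auto
  obtain v' where v': "v' \<in> topspace X" "\<bar>\<phi> z - \<phi> v'\<bar> < \<epsilon>/8" "mv_dist (y n) v' \<in> S (Suc n)"
    using near_z[OF X(2) zy] by blast
  show False
    using far[of n] xn[OF v(1,3)] yn[OF v'(1,3)] v(2) v'(2) \<epsilon> by linarith
qed

text \<open>Otherwise points could be chosen one after another with all mutual distances outside
  \<open>S\<close>, yet two of them come close to a common cluster point.\<close>

lemma totally_bounded_dist:
  assumes S: "solid_nbhd S"
  shows "\<exists>F. finite F \<and> F \<subseteq> topspace X \<and> (\<forall>x\<in>topspace X. \<exists>c\<in>F. mv_dist c x \<in> S)"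
proof (rule ccontr)
  assume neg: "\<not> ?thesis"
  define P where "P = (\<lambda>(F, c). finite F \<and> F \<subseteq> topspace X \<and> c \<in> F)"
  define Q where "Q = (\<lambda>(F, c :: 'a) (G, d). F \<subseteq> G \<and> (\<forall>b\<in>F. mv_dist b d \<notin> S))"
  have ex1: "\<exists>\<tau>. P \<tau> \<and> Q \<sigma> \<tau>" if "P \<sigma>" for \<sigma>
  proof -
    obtain F c where \<sigma>: "\<sigma> = (F, c)"
      by (metis prod.exhaust)
    then have F: "finite F" "F \<subseteq> topspace X"
      using that by (auto simp: P_def)
    then obtain x where "x \<in> topspace X" "\<forall>b\<in>F. mv_dist b x \<notin> S"
      using neg by meson
    then have "P (insert x F, x) \<and> Q \<sigma> (insert x F, x)"
      using F unfolding P_def Q_def \<sigma> by auto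
    then show ?thesis
      by blast
  qed
  have ex0: "\<exists>\<sigma>. P \<sigma>"
    using zero_closed by (intro exI[of _ "({zero}, zero)"]) (simp add: P_def)
  obtain \<sigma> where \<sigma>: "\<And>n. P (\<sigma> n)" "\<And>n. Q (\<sigma> n) (\<sigma> (Suc n))"
    using dependent_nat_choice[of "\<lambda>n. P" "\<lambda>n. Q"] ex0 ex1 by metis
  define F where "F n = fst (\<sigma> n)" for n
  define c where "c n = snd (\<sigma> n)" for n
  have eq: "\<sigma> n = (F n, c n)" for n
    by (simp add: F_def c_def)
  have p: "c n \<in> F n" "c n \<in> topspace X" for n
    using \<sigma>(1)[of n] unfolding eq P_def by auto
  have q: "F n \<subseteq> F (Suc n)" "\<forall>b\<in>F n. mv_dist b (c (Suc n)) \<notin> S" for n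
    using \<sigma>(2)[of n] unfolding eq Q_def by auto
  have Fm: "F m \<subseteq> F n" if "m \<le> n" for m n
    using q(1) lift_Suc_mono_le that by metis
  have sep: "mv_dist (c m) (c n) \<notin> S" if mn: "m < n" for m n
  proof -
    obtain l where l: "n = Suc l" "m \<le> l"
      using mn by (cases n) auto
    then have "c m \<in> F l"
      using Fm p(1) by blast
    then show ?thesis
      using q(2)[of l] l(1) by simp
  qed
  obtain T where T: "solid_nbhd T" "\<forall>a\<in>T. \<forall>b\<in>T. a \<oplus> b \<in> S"
    using solid_nbhd_half[OF S] by blast
  obtain R where R: "solid_nbhd R" "\<forall>a\<in>R. \<forall>b\<in>R. a \<oplus> b \<in> T"
    using solid_nbhd_half[OF T(1)] by blast
  obtain z where z: "z \<in> topspace X" and near: "\<forall>S N. solid_nbhd S \<longrightarrow>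
      (\<exists>n\<ge>N. \<exists>y\<in>topspace X. mv_dist z y \<in> S \<and> mv_dist (c n) y \<in> R)"
    using cluster_point_of_balls[of "\<lambda>n. R" c] R p by blast
  have "\<exists>n\<ge>N. mv_dist z (c n) \<in> T" for N
  proof -
    obtain n y where "n \<ge> N" and y: "y \<in> topspace X" "mv_dist z y \<in> R" "mv_dist (c n) y \<in> R"
      using near R(1) by blast
    moreover have "mv_dist y (c n) \<in> R"
      using y p(2)[of n] mv_dist_commute[of y "c n"] by simp
    ultimately show ?thesis
      using solid_nbhd_dist_trans[OF T(1) y(2) _ R(2) z y(1) p(2)] by blast
  qed
  then obtain m n where T2: "mv_dist z (c m) \<in> T" "mv_dist z (c n) \<in> T" and "Suc m \<le> n"
    by blast
  then have mn: "m < n"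
    by simp
  have "mv_dist (c m) z \<in> T"
    using T2(1) z p(2)[of m] mv_dist_commute[of z "c m"] by simp
  then have "mv_dist (c m) (c n) \<in> S"
    by (rule solid_nbhd_dist_trans[OF S _ T2(2) T(2) p(2) z p(2)])
  then show False
    using sep mn by blast
qed

lemma translates_totally_bounded:
  assumes \<phi>: "continuous_map X euclideanreal \<phi>" and \<epsilon>: "0 < \<epsilon>"
  shows "\<exists>F. finite F \<and> F \<subseteq> topspace X \<and>
    (\<forall>y\<in>topspace X. \<exists>c\<in>F. \<forall>x\<in>topspace X. \<bar>\<phi> (x \<oplus> c) - \<phi> (x \<oplus> y)\<bar> < \<epsilon>)"
proof -
  obtain S where S: "solid_nbhd S"
    and uc: "\<forall>x\<in>topspace X. \<forall>y\<in>topspace X. mv_dist x y \<in> S \<longrightarrow> \<bar>\<phi> x - \<phi> y\<bar> < \<epsilon>"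
    using uniformly_continuous_real[OF \<phi> \<epsilon>] by blast
  obtain F where F: "finite F" "F \<subseteq> topspace X" "\<forall>y\<in>topspace X. \<exists>c\<in>F. mv_dist c y \<in> S"
    using totally_bounded_dist[OF S] by blast
  have "\<bar>\<phi> (x \<oplus> c) - \<phi> (x \<oplus> y)\<bar> < \<epsilon>"
    if "x \<in> topspace X" "y \<in> topspace X" "c \<in> topspace X" "mv_dist c y \<in> S" for x y c
  proof -
    have "mv_dist (c \<oplus> x) (y \<oplus> x) \<in> S"
      using that by (intro solid_nbhdD(3)[OF S that(4)] mv_dist_plus_le closed)
    then show ?thesis
      using uc that by (simp add: plus_commute closed)
  qed
  then have "\<exists>c\<in>F. \<forall>x\<in>topspace X. \<bar>\<phi> (x \<oplus> c) - \<phi> (x \<oplus> y)\<bar> < \<epsilon>"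
    if y: "y \<in> topspace X" for y
    using F(2,3) y by (meson subsetD)
  then show ?thesis
    using F(1,2) by (intro exI[of _ F]) simp
qed

end

section \<open>Extension to the Stone--Cech compactification\<close>

lemma continuous_map_dense_eq:
  assumes "Hausdorff_space Z" "continuous_map Y Z f" "continuous_map Y Z g"
    and "Y closure_of D = topspace Y" "\<And>x. x \<in> D \<Longrightarrow> f x = g x" "y \<in> topspace Y"
  shows "f y = g y"
  using forall_in_closure_of_eq[of y Y D Z f g] assms by simp

lemma topological_MV_algebra_dense_extension:
  assumes "MV_algebra (topspace X) oplus neg zero" and Y: "Tychonoff_space Y"
    and e: "e ` topspace X \<subseteq> topspace Y" and dense: "Y closure_of (e ` topspace X) = topspace Y"
    and ext: "continuous_extension_of_operations X oplus neg zero Y oplus' neg' zero' e"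
  shows "topological_MV_algebra Y oplus' neg' zero'"
proof -
  interpret MV_algebra "topspace X" oplus neg zero
    by fact
  let ?D = "e ` topspace X" and ?Y2 = "prod_topology Y Y" and ?Y3 = "prod_topology Y (prod_topology Y Y)"
  have H: "Hausdorff_space Y"
    using Y by (simp add: Tychonoff_space_def)
  have plus: "continuous_map ?Y2 Y (\<lambda>(p, q). oplus' p q)" and neg: "continuous_map Y Y neg'"
    and pe: "\<And>x y. \<lbrakk>x \<in> topspace X; y \<in> topspace X\<rbrakk> \<Longrightarrow> oplus' (e x) (e y) = e (oplus x y)"
    and ne: "\<And>x. x \<in> topspace X \<Longrightarrow> neg' (e x) = e (neg x)" and ze: "zero' = e zero"
    using ext by (auto simp: continuous_extension_of_operations_def)
  have zY: "zero' \<in> topspace Y"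
    using ze e zero_closed by blast
  \<comment> \<open>\<open>Z\<close> has a type of its own, so that these facts build continuous
    terms over \<open>Y\<close>, its square and its cube alike.\<close>
  have cp: "continuous_map Z Y (\<lambda>z. oplus' (f z) (g z))"
    if "continuous_map Z Y f" "continuous_map Z Y g" for Z :: "'z topology" and f g
  proof -
    have "continuous_map Z ?Y2 (\<lambda>z. (f z, g z))"
      using that by (simp add: continuous_map_pairwise o_def)
    from continuous_map_compose[OF this plus] show ?thesis
      by (simp add: o_def)
  qed
  have cn: "continuous_map Z Y (\<lambda>z. neg' (f z))" if "continuous_map Z Y f" for Z :: "'z topology" and f
    using continuous_map_compose[OF that neg] by (simp add: o_def)
  have cz: "continuous_map Z Y (\<lambda>z. zero')" for Z :: "'z topology"
    using zY by simp
  have D2: "?Y2 closure_of (?D \<times> ?D) = topspace ?Y2"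
    by (simp add: closure_of_Times dense)
  have D3: "?Y3 closure_of (?D \<times> ?D \<times> ?D) = topspace ?Y3"
    by (simp add: closure_of_Times dense)
  have id: "continuous_map Y Y (\<lambda>z. z)"
    by simp
  have f2: "continuous_map ?Y2 Y (\<lambda>z. fst z)" "continuous_map ?Y2 Y (\<lambda>z. snd z)"
    using continuous_map_fst continuous_map_snd by auto
  have f3: "continuous_map ?Y3 Y (\<lambda>z. fst z)" "continuous_map ?Y3 Y (\<lambda>z. fst (snd z))"
    "continuous_map ?Y3 Y (\<lambda>z. snd (snd z))"
    using continuous_map_fst[of Y ?Y2]
      continuous_map_compose[OF continuous_map_snd[of Y ?Y2] continuous_map_fst]
      continuous_map_compose[OF continuous_map_snd[of Y ?Y2] continuous_map_snd]
    by (auto simp: o_def)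
  note extend = pe ne ze plus_closed neg_closed zero_closed
  show ?thesis
  proof
    show "oplus' x y \<in> topspace Y" if "x \<in> topspace Y" "y \<in> topspace Y" for x y
      using continuous_map_image_subset_topspace[OF plus] that by force
    show "neg' x \<in> topspace Y" if "x \<in> topspace Y" for x
      using continuous_map_image_subset_topspace[OF neg] that by blast
    show "oplus' (oplus' x y) z = oplus' x (oplus' y z)"
      if "x \<in> topspace Y" "y \<in> topspace Y" "z \<in> topspace Y" for x y z
    proof -
      have "oplus' (oplus' (fst w) (fst (snd w))) (snd (snd w)) =
          oplus' (fst w) (oplus' (fst (snd w)) (snd (snd w)))" if "w \<in> ?D \<times> ?D \<times> ?D" for w
        using that by (auto simp: extend plus_assoc)
      from continuous_map_dense_eq[OF H cp[OF cp[OF f3(1,2)] f3(3)] cp[OF f3(1) cp[OF f3(2,3)]] D3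
          this, of "(x, y, z)"] show ?thesis
        using that by simp
    qed
    show "oplus' x y = oplus' y x" if "x \<in> topspace Y" "y \<in> topspace Y" for x y
    proof -
      have "oplus' (fst w) (snd w) = oplus' (snd w) (fst w)" if "w \<in> ?D \<times> ?D" for w
        using that by (auto simp: extend plus_commute)
      from continuous_map_dense_eq[OF H cp[OF f2] cp[OF f2(2,1)] D2 this, of "(x, y)"]
      show ?thesis
        using that by simp
    qed
    show "oplus' x zero' = x" if "x \<in> topspace Y" for x
    proof -
      have "oplus' w zero' = w" if "w \<in> ?D" for w
        using that by (auto simp: extend plus_zero)
      from continuous_map_dense_eq[OF H cp[OF id cz] id dense this that] show ?thesis .
    qed
    show "neg' (neg' x) = x" if "x \<in> topspace Y" for x
    proof -
      have "neg' (neg' w) = w" if "w \<in> ?D" for w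
        using that by (auto simp: extend neg_neg)
      from continuous_map_dense_eq[OF H cn[OF cn[OF id]] id dense this that] show ?thesis .
    qed
    show "oplus' x (neg' zero') = neg' zero'" if "x \<in> topspace Y" for x
    proof -
      have "oplus' w (neg' zero') = neg' zero'" if "w \<in> ?D" for w
        using that by (auto simp: extend plus_neg_zero)
      from continuous_map_dense_eq[OF H cp[OF id cn[OF cz]] cn[OF cz] dense this that] show ?thesis .
    qed
    show "oplus' (neg' (oplus' (neg' x) y)) y = oplus' (neg' (oplus' (neg' y) x)) x"
      if "x \<in> topspace Y" "y \<in> topspace Y" for x y
    proof -
      have "oplus' (neg' (oplus' (neg' (fst w)) (snd w))) (snd w) =
          oplus' (neg' (oplus' (neg' (snd w)) (fst w))) (fst w)" if "w \<in> ?D \<times> ?D" for w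
        using that by (auto simp: extend lukasiewicz)
      from continuous_map_dense_eq[OF H cp[OF cn[OF cp[OF cn[OF f2(1)] f2(2)]] f2(2)]
          cp[OF cn[OF cp[OF cn[OF f2(2)] f2(1)]] f2(1)] D2 this, of "(x, y)"]
      show ?thesis
        using that by simp
    qed
  qed (use Y zY plus neg in auto)
qed

text \<open>A finite net of translates reduces the oscillation of \<open>g\<close> in one variable,
  uniformly in the other, to finitely many functions of one variable, which do extend. Symmetry
  treats the other variable, and completeness of the reals turns zero oscillation into
  limits.\<close>

lemma stone_cech_extension_two_variables:
  fixes g :: "'a \<Rightarrow> 'a \<Rightarrow> real"
  assumes X: "Tychonoff_space X"
    and g: "\<And>y. y \<in> topspace X \<Longrightarrow> continuous_map X (top_of_set {0..1}) (\<lambda>x. g x y)"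
    and comm: "\<And>x y. \<lbrakk>x \<in> topspace X; y \<in> topspace X\<rbrakk> \<Longrightarrow> g x y = g y x"
    and tb: "\<And>\<epsilon>. 0 < \<epsilon> \<Longrightarrow> \<exists>F. finite F \<and> F \<subseteq> topspace X \<and>
      (\<forall>y\<in>topspace X. \<exists>c\<in>F. \<forall>x\<in>topspace X. \<bar>g x c - g x y\<bar> < \<epsilon>)"
  shows "\<exists>G. continuous_map (prod_topology (stone_cech X) (stone_cech X)) (top_of_set {0..1}) G \<and>
    (\<forall>x\<in>topspace X. \<forall>y\<in>topspace X.
      G (stone_cech_embedding X x, stone_cech_embedding X y) = g x y)"
proof -
  let ?B = "stone_cech X" and ?e = "stone_cech_embedding X"
  let ?K = "prod_topology ?B ?B" and ?S = "(?e ` topspace X) \<times> (?e ` topspace X)"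
  have emb: "dense_embedding X ?B ?e"
    by (rule dense_embedding_stone_cech[OF X])
  then have inj: "inj_on ?e (topspace X)"
    unfolding dense_embedding_def embedding_map_def
    using homeomorphic_imp_injective_map by blast
  have dense: "?K closure_of ?S = topspace ?K"
    using emb by (simp add: closure_of_Times dense_embedding_def)
  have SK: "?S \<subseteq> topspace ?K"
    using stone_cech_embedding_in[of X] by auto
  define e' where "e' = inv_into (topspace X) ?e"
  have e': "e' (?e x) = x" if "x \<in> topspace X" for x
    unfolding e'_def using inj that by simp
  define f where "f = (\<lambda>(p, q). g (e' p) (e' q))"
  have fe: "f (?e x, ?e y) = g x y" if "x \<in> topspace X" "y \<in> topspace X" for x y
    by (simp add: f_def e' that)
  have osc1: "\<exists>U. openin ?B U \<and> p \<in> U \<and> (\<forall>x\<in>topspace X. \<forall>x'\<in>topspace X. ?e x \<in> U \<longrightarrow> ?e x' \<in> U \<longrightarrow>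
      (\<forall>y\<in>topspace X. \<bar>g x y - g x' y\<bar> < \<epsilon>))"
    if p: "p \<in> topspace ?B" and \<epsilon>: "0 < \<epsilon>" for p \<epsilon>
  proof -
    \<comment> \<open>Two quarters pay for exchanging \<open>y\<close> and the net point
      \<open>c\<close>, two for comparing with the extended value at \<open>p\<close>.\<close>
    obtain F where F: "finite F" "F \<subseteq> topspace X"
      and Fc: "\<forall>y\<in>topspace X. \<exists>c\<in>F. \<forall>x\<in>topspace X. \<bar>g x c - g x y\<bar> < \<epsilon>/4"
      using tb[of "\<epsilon>/4"] \<epsilon> by auto
    have "\<exists>h. continuous_map ?B euclideanreal h \<and> (\<forall>x\<in>topspace X. h (?e x) = g x c)"
      if c: "c \<in> F" for c
    proof -
      have comp: "compact_space (top_of_set {0..1::real})" "Hausdorff_space (top_of_set {0..1::real})"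
        by (auto simp: compact_space_subtopology Hausdorff_space_subtopology)
      have "continuous_map X (top_of_set {0..1}) (\<lambda>x. g x c)"
        using g c F by blast
      then obtain h where "continuous_map ?B (top_of_set {0..1}) h"
        "\<And>x. x \<in> topspace X \<Longrightarrow> h (?e x) = g x c"
        using stone_cech_extension[OF comp] by metis
      then show ?thesis
        by (auto simp: continuous_map_in_subtopology)
    qed
    then obtain h where h: "\<And>c. c \<in> F \<Longrightarrow> continuous_map ?B euclideanreal (h c)"
      and he: "\<And>c x. \<lbrakk>c \<in> F; x \<in> topspace X\<rbrakk> \<Longrightarrow> h c (?e x) = g x c"
      by metis
    define U where "U = topspace ?B \<inter> (\<Inter>c\<in>F. {r \<in> topspace ?B. h c r \<in> ball (h c p) (\<epsilon>/4)})"
    have "openin ?B {r \<in> topspace ?B. h c r \<in> ball (h c p) (\<epsilon>/4)}" if "c \<in> F" for c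
      using openin_continuous_map_preimage[OF h[OF that]] open_openin by blast
    then have "openin ?B U"
      unfolding U_def using F(1)
      by (cases "F = {}") (simp, intro openin_Int openin_INT2 openin_topspace)
    moreover have "p \<in> U"
      unfolding U_def using p \<epsilon> by auto
    moreover have "\<bar>g x y - g x' y\<bar> < \<epsilon>" if xy: "x \<in> topspace X" "x' \<in> topspace X" "?e x \<in> U"
      "?e x' \<in> U" "y \<in> topspace X" for x x' y
    proof -
      obtain c where c: "c \<in> F" "\<forall>x\<in>topspace X. \<bar>g x c - g x y\<bar> < \<epsilon>/4"
        using Fc xy(5) by blast
      have "\<bar>h c p - g x c\<bar> < \<epsilon>/4" "\<bar>h c p - g x' c\<bar> < \<epsilon>/4"
        using xy c(1) he unfolding U_def by (auto simp: dist_real_def)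
      moreover have "\<bar>g x c - g x y\<bar> < \<epsilon>/4" "\<bar>g x' c - g x' y\<bar> < \<epsilon>/4"
        using c(2) xy by auto
      ultimately show ?thesis
        by linarith
    qed
    ultimately show ?thesis
      by blast
  qed
  \<comment> \<open>This serves twice: for continuity of \<open>f\<close> on \<open>?S\<close> and
    for limits at the remaining points.\<close>
  have osc: "\<exists>U. openin ?K U \<and> a \<in> U \<and> (\<forall>z\<in>?S \<inter> U. \<forall>z'\<in>?S \<inter> U. dist (f z) (f z') < \<epsilon>)"
    if a: "a \<in> topspace ?K" and \<epsilon>: "0 < \<epsilon>" for a \<epsilon>
  proof -
    obtain p q where pq: "a = (p, q)" "p \<in> topspace ?B" "q \<in> topspace ?B"
      using a by auto
    obtain U where U: "openin ?B U" "p \<in> U" "\<forall>x\<in>topspace X. \<forall>x'\<in>topspace X. ?e x \<in> U \<longrightarrow> ?e x' \<in> U \<longrightarrow>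
      (\<forall>y\<in>topspace X. \<bar>g x y - g x' y\<bar> < \<epsilon>/2)"
      using osc1[OF pq(2), of "\<epsilon>/2"] \<epsilon> by auto
    obtain V where V: "openin ?B V" "q \<in> V" "\<forall>x\<in>topspace X. \<forall>x'\<in>topspace X. ?e x \<in> V \<longrightarrow> ?e x' \<in> V \<longrightarrow>
      (\<forall>y\<in>topspace X. \<bar>g x y - g x' y\<bar> < \<epsilon>/2)"
      using osc1[OF pq(3), of "\<epsilon>/2"] \<epsilon> by auto
    have "\<bar>g x y - g x' y'\<bar> < \<epsilon>" if xy: "x \<in> topspace X" "x' \<in> topspace X" "y \<in> topspace X"
      "y' \<in> topspace X" "?e x \<in> U" "?e x' \<in> U" "?e y \<in> V" "?e y' \<in> V" for x y x' y'
    proof -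
      have "\<bar>g x y - g x' y\<bar> < \<epsilon>/2" "\<bar>g y x' - g y' x'\<bar> < \<epsilon>/2"
        using U(3) V(3) xy by auto
      then show ?thesis
        using comm[of x' y] comm[of x' y'] xy by linarith
    qed
    then have "\<forall>z\<in>?S \<inter> U \<times> V. \<forall>z'\<in>?S \<inter> U \<times> V. dist (f z) (f z') < \<epsilon>"
      by (auto simp: fe dist_real_def)
    moreover have "openin ?K (U \<times> V)"
      using U(1) V(1) by (simp add: openin_prod_Times_iff)
    ultimately show ?thesis
      using U(2) V(2) pq(1) by (intro exI[of _ "U \<times> V"]) auto
  qed
  have cont: "continuous_map (subtopology ?K ?S) euclideanreal f"
    unfolding continuous_map_eq_topcontinuous_at topcontinuous_at_def
  proof (intro ballI conjI allI impI)
    fix a V assume "a \<in> topspace (subtopology ?K ?S)" and V: "openin euclideanreal V \<and> f a \<in> V"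
    then have a: "a \<in> ?S" "a \<in> topspace ?K"
      by auto
    obtain \<epsilon> where \<epsilon>: "0 < \<epsilon>" "ball (f a) \<epsilon> \<subseteq> V"
      using V open_contains_ball by (metis open_openin)
    obtain U where U: "openin ?K U" "a \<in> U" "\<forall>z\<in>?S \<inter> U. \<forall>z'\<in>?S \<inter> U. dist (f z) (f z') < \<epsilon>"
      using osc[OF a(2) \<epsilon>(1)] by blast
    have "openin (subtopology ?K ?S) (?S \<inter> U)"
      using U(1) by (simp add: openin_subtopology_Int2)
    moreover have "\<forall>z\<in>?S \<inter> U. f z \<in> V"
      using U(2,3) a(1) \<epsilon>(2) by (auto simp: subset_iff)
    ultimately show "\<exists>U. openin (subtopology ?K ?S) U \<and> a \<in> U \<and> (\<forall>y\<in>U. f y \<in> V)"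
      using a(1) U(2) by (intro exI[of _ "?S \<inter> U"]) auto
  qed auto
  have lim: "\<exists>l. limitin euclideanreal f l (atin_within ?K a ?S)" if "a \<in> topspace ?K - ?S" for a
  proof -
    have "\<exists>l. limitin Met_TC.mtopology f l (atin_within ?K a ?S)"
    proof (subst Met_TC.convergent_eq_zero_oscillation_gen)
      show "Met_TC.mcomplete TYPE(real)"
        by (simp add: mcomplete_iff_complete complete_UNIV)
      have "\<exists>U. openin ?K U \<and> a \<in> U \<and>
          (\<forall>x\<in>?S \<inter> U - {a}. \<forall>y\<in>?S \<inter> U - {a}. dist (f x) (f y) < \<epsilon>)" if "0 < \<epsilon>" for \<epsilon>
        using osc[of a \<epsilon>] that \<open>a \<in> topspace ?K - ?S\<close> by (meson DiffD1)
      then show "UNIV \<noteq> {} \<and> (a \<in> topspace ?K \<longrightarrow> (\<forall>\<epsilon>>0. \<exists>U. openin ?K U \<and> a \<in> U \<and>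
          (\<forall>x\<in>?S \<inter> U - {a}. \<forall>y\<in>?S \<inter> U - {a}. dist (f x) (f y) < \<epsilon>)))"
        by simp
    qed auto
    then show ?thesis
      by simp
  qed
  obtain G where G: "continuous_map (subtopology ?K (topspace ?K)) euclideanreal G"
    and Gf: "\<And>z. z \<in> ?S \<Longrightarrow> G z = f z"
    using continuous_map_extension_pointwise_alt[of euclideanreal ?S "topspace ?K" ?K f]
      SK dense cont lim by (metis order_refl regular_space_euclidean)
  have GK: "continuous_map ?K euclideanreal G"
    using G by (simp only: subtopology_topspace)
  have "G ` topspace ?K \<subseteq> closure (G ` ?S)"
    using continuous_map_image_closure_subset[OF GK, of ?S] dense by simp
  also have "\<dots> \<subseteq> {0..1}"
  proof (rule closure_minimal)
    have "g x y \<in> {0..1}" if "x \<in> topspace X" "y \<in> topspace X" for x y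
      using continuous_map_image_subset_topspace[OF g[OF that(2)]] that(1)
      by (simp add: image_subset_iff)
    then show "G ` ?S \<subseteq> {0..1}"
      by (simp add: image_subset_iff Gf fe del: atLeastAtMost_iff)
  qed simp
  finally have "continuous_map ?K (top_of_set {0..1}) G"
    using GK by (auto simp: continuous_map_in_subtopology)
  then show ?thesis
    using Gf fe by auto
qed

text \<open>Built coordinatewise in the cube, the coordinate \<open>\<phi>\<close> being the
  extension of \<open>\<phi> (oplus x y)\<close>. The values stay in the compactification because it
  is the closure of the embedded algebra, which contains the values on a dense set.\<close>

lemma stone_cech_extension_plus:
  assumes A: "topological_MV_algebra A oplus neg zero" and pc: "pseudocompact_space A"
  shows "\<exists>M. continuous_map (prod_topology (stone_cech A) (stone_cech A)) (stone_cech A) M \<and>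
    (\<forall>x\<in>topspace A. \<forall>y\<in>topspace A. M (stone_cech_embedding A x, stone_cech_embedding A y) =
       stone_cech_embedding A (oplus x y))"
proof -
  interpret pseudocompact_MV_algebra A oplus neg zero
    using A pc by (simp add: pseudocompact_MV_algebra_def pseudocompact_MV_algebra_axioms_def)
  let ?B = "stone_cech A" and ?e = "stone_cech_embedding A"
  let ?K = "prod_topology ?B ?B" and ?S = "(?e ` topspace A) \<times> (?e ` topspace A)"
  have dense: "?K closure_of ?S = topspace ?K"
    using dense_embedding_stone_cech[OF Tychonoff] by (simp add: closure_of_Times dense_embedding_def)
  have "\<exists>G. continuous_map ?K (top_of_set {0..1}) G \<and>
    (\<forall>x\<in>topspace A. \<forall>y\<in>topspace A. G (?e x, ?e y) = \<phi> (oplus x y))"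
    if \<phi>: "\<phi> \<in> unit_functions A" for \<phi>
  proof (rule stone_cech_extension_two_variables[OF Tychonoff])
    have c: "continuous_map A (top_of_set {0..1}) \<phi>"
      using \<phi> by (simp add: unit_functions_def)
    then have c': "continuous_map A euclideanreal \<phi>"
      by (simp add: continuous_map_in_subtopology)
    show "continuous_map A (top_of_set {0..1}) (\<lambda>x. \<phi> (oplus x y))" if "y \<in> topspace A" for y
    proof -
      have "continuous_map A A (\<lambda>x. oplus x y)"
        using that by (intro continuous_map_mv_plus) auto
      from continuous_map_compose[OF this c] show ?thesis
        by (simp add: o_def)
    qed
    show "\<phi> (oplus x y) = \<phi> (oplus y x)" if "x \<in> topspace A" "y \<in> topspace A" for x y
      using that plus_commute by simp
    show "\<exists>F. finite F \<and> F \<subseteq> topspace A \<and>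
      (\<forall>y\<in>topspace A. \<exists>c\<in>F. \<forall>x\<in>topspace A. \<bar>\<phi> (oplus x c) - \<phi> (oplus x y)\<bar> < \<epsilon>)"
      if "0 < \<epsilon>" for \<epsilon>
      by (rule translates_totally_bounded[OF c' that])
  qed
  then obtain G where G: "\<And>\<phi>. \<phi> \<in> unit_functions A \<Longrightarrow> continuous_map ?K (top_of_set {0..1}) (G \<phi>)"
    and Ge: "\<And>\<phi> x y. \<lbrakk>\<phi> \<in> unit_functions A; x \<in> topspace A; y \<in> topspace A\<rbrakk> \<Longrightarrow>
      G \<phi> (?e x, ?e y) = \<phi> (oplus x y)"
    by metis
  define M where "M z = (\<lambda>\<phi>\<in>unit_functions A. G \<phi> z)" for z
  have "continuous_map ?K (unit_cube A) M"
    unfolding unit_cube_def continuous_map_componentwise using G by (auto simp: M_def)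
  moreover have Me: "M (?e x, ?e y) = ?e (oplus x y)" if "x \<in> topspace A" "y \<in> topspace A" for x y
    unfolding M_def stone_cech_embedding_def[of A "oplus x y"]
    by (rule restrict_ext) (rule Ge[OF _ that])
  moreover have "M ` topspace ?K \<subseteq> topspace ?B"
  proof -
    have "M ` ?S \<subseteq> ?e ` topspace A"
      using Me plus_closed by auto
    then show ?thesis
      using continuous_map_image_closure_subset[OF calculation(1), of ?S]
        closure_of_mono[of "M ` ?S" "?e ` topspace A" "unit_cube A"]
      by (simp add: dense topspace_stone_cech)
  qed
  ultimately have "continuous_map ?K (subtopology (unit_cube A) (topspace ?B)) M"
    by (simp add: continuous_map_in_subtopology image_subset_iff_funcset)
  moreover have "subtopology (unit_cube A) (topspace ?B) = ?B"
    by (simp only: topspace_stone_cech) (simp only: stone_cech_def)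
  ultimately have "continuous_map ?K ?B M"
    by simp
  then show ?thesis
    using Me by blast
qed

theorem theorem4p1:
  fixes A :: "'a topology"
    and oplus :: "'a \<Rightarrow> 'a \<Rightarrow> 'a"
    and neg :: "'a \<Rightarrow> 'a"
    and zero :: 'a
  assumes "topological_MV_algebra A oplus neg zero"
    and "pseudocompact_space A"
  shows "\<exists>oplus' neg' zero'.
           topological_MV_algebra (stone_cech A) oplus' neg' zero' \<and>
           compact_space (stone_cech A) \<and>
           continuous_extension_of_operations A oplus neg zero
             (stone_cech A) oplus' neg' zero' (stone_cech_embedding A) \<and>
           dense_embedding A (stone_cech A) (stone_cech_embedding A) \<and>
           MV_homomorphism (topspace A) oplus neg zero
             (topspace (stone_cech A)) oplus' neg' zero' (stone_cech_embedding A)"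
proof -
  let ?B = "stone_cech A" and ?e = "stone_cech_embedding A"
  interpret topological_MV_algebra A oplus neg zero
    by fact
  have dense: "dense_embedding A ?B ?e"
    by (rule dense_embedding_stone_cech[OF Tychonoff])
  have eB: "?e ` topspace A \<subseteq> topspace ?B"
    by (rule stone_cech_embedding_in)
  have B: "compact_space ?B" "Hausdorff_space ?B"
    by (rule compact_space_stone_cech, rule Hausdorff_space_stone_cech)
  then have TB: "Tychonoff_space ?B"
    unfolding Tychonoff_space_def
    using compact_Hausdorff_or_regular_imp_normal_space normal_imp_completely_regular_space by blast
  obtain M where M: "continuous_map (prod_topology ?B ?B) ?B M"
    and Me: "\<forall>x\<in>topspace A. \<forall>y\<in>topspace A. M (?e x, ?e y) = ?e (oplus x y)"
    using stone_cech_extension_plus[OF assms] by blast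
  have "continuous_map A ?B ?e"
    using dense homeomorphic_imp_continuous_map continuous_map_in_subtopology
    unfolding dense_embedding_def embedding_map_def by blast
  \<comment> \<open>Negation is unary, so the universal property extends it at once.\<close>
  then have "continuous_map A ?B (?e \<circ> neg)"
    using continuous_neg continuous_map_compose by blast
  then obtain neg' where neg': "continuous_map ?B ?B neg'"
    and ne: "\<And>x. x \<in> topspace A \<Longrightarrow> neg' (?e x) = (?e \<circ> neg) x"
    using stone_cech_extension[OF B] by metis
  define oplus' where "oplus' p q = M (p, q)" for p q
  have "(\<lambda>(p, q). oplus' p q) = M"
    by (auto simp: oplus'_def)
  then have plus': "continuous_map (prod_topology ?B ?B) ?B (\<lambda>(p, q). oplus' p q)"
    using M by simp
  have opl: "oplus' (?e x) (?e y) = ?e (oplus x y)" if "x \<in> topspace A" "y \<in> topspace A" for x y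
    using Me that by (simp add: oplus'_def)
  have ext: "continuous_extension_of_operations A oplus neg zero ?B oplus' neg' (?e zero) ?e"
    unfolding continuous_extension_of_operations_def
    using plus' opl neg' ne by simp
  have "topological_MV_algebra ?B oplus' neg' (?e zero)"
    using topological_MV_algebra_dense_extension[OF MV_algebra_axioms TB eB _ ext] dense
    by (simp add: dense_embedding_def)
  moreover have "MV_homomorphism (topspace A) oplus neg zero (topspace ?B) oplus' neg' (?e zero) ?e"
    using eB ext by (simp add: MV_homomorphism_def continuous_extension_of_operations_def)
  ultimately show ?thesis
    using B(1) ext dense by blast
qed

end
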